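(* Let $X$ be a random variable on a finite alphabet $\mathcal X$, let $Z=g(X)$ for some function $g$, and let $Y$ be the output of an erasure channel with input $X$ and erasure probability $\epsilon\in[0,1]$: $Y=X$ with probability $1-\epsilon$ and $Y=e$ with probability $\epsilon$, independently of $X$, where $e\notin\mathcal X$ is an erasure symbol. Then $$S(X;Y\|Z)=I(X;Y|Z)=(1-\epsilon)H(X|Z),$$ and this rate is achievable by one-way communication from Alice to Bob, i.e. $S_{\mathrm{ow}}(X\to Y\|Z)=I(X;Y|Z)$.
   Context: All random variables have finite alphabets. $H$ and $I$ denote Shannon entropy and mutual information. Key agreement model. $(X^n,Y^n,Z^n)$ are $n$ i.i.d. copies of $(X,Y,Z)$; Alice, Bob, Eve observe $X^n$, $Y^n$, $Z^n$ respectively. In an interactive protocol with $r$ rounds ($r$ arbitrary), public messages are generated successively: for odd $i$, Alice generates $F_i$ according to some $P_{F_i|X^n,F_{1:i-1}}$; for even $i$, Bob generates $F_i$ according to some $P_{F_i|Y^n,F_{1:i-1}}$. Then Alice generates $K_A$ according to $P_{K_A|X^n,F_{1:r}}$ and Bob generates $K_B$ according to $P_{K_B|Y^n,F_{1:r}}$, both in an alphabet $\mathcal K$. This is an $(n,R,\delta)$ code if $R=\frac1nH(K_A)$ and $$\mathbb P[K_A=K_B]\ge1-\delta,\qquad R\ge\tfrac1n\log|\mathcal K|-\delta,\qquad \tfrac1n I(K_A;Z^n,F_{1:r})\le\delta.$$ A rate $R$ is achievable if for every $\delta>0$ there is an $(n,R,\delta)$ code for some $n$; $S(X;Y\|Z)$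 is the supremum of achievable rates. The one-way secret key capacity (only Alice sends a public message to Bob) is known to equal $$S_{\mathrm{ow}}(X\to Y\|Z)=\max_{(U,V)} \big[I(U;Y|V)-I(U;Z|V)\big],$$ the maximum being over finite-alphabet $(U,V)$ such that $(U,V)$ and $(Y,Z)$ are conditionally independent given $X$. The known bounds $S_{\mathrm{ow}}(X\to Y\|Z)\le S(X;Y\|Z)\le I(X;Y|Z)$ hold. *)

theory Defs
  imports "HOL-Probability.Probability"
begin

section \<open>Information quantities of finitely supported laws\<close>

text \<open>The information measures of \<^theory>\<open>HOL-Probability.Information\<close> take discrete variables
  with respect to the counting measure on their range, and need that range to be finite. Hence a
  finitely supported pmf is turned into a probability space on its support rather than on the whole
  type. The parameter \<open>b > 1\<close> is the base of all logarithms.\<close>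

definition support_space :: "'w pmf \<Rightarrow> 'w measure" where
  "support_space P = point_measure (set_pmf P) (pmf P)"

abbreviation range_space :: "'w pmf \<Rightarrow> ('w \<Rightarrow> 'a) \<Rightarrow> 'a measure" where
  "range_space P A \<equiv> count_space (A ` set_pmf P)"

definition ent :: "real \<Rightarrow> 'w pmf \<Rightarrow> ('w \<Rightarrow> 'a) \<Rightarrow> real" where
  "ent b P A = prob_space.entropy (support_space P) b (range_space P A) A"

definition cond_ent :: "real \<Rightarrow> 'w pmf \<Rightarrow> ('w \<Rightarrow> 'a) \<Rightarrow> ('w \<Rightarrow> 'c) \<Rightarrow> real" where
  "cond_ent b P A C =
     prob_space.conditional_entropy (support_space P) b (range_space P A) (range_space P C) A C"

definition mut_inf :: "real \<Rightarrow> 'w pmf \<Rightarrow> ('w \<Rightarrow> 'a) \<Rightarrow> ('w \<Rightarrow> 'b) \<Rightarrow> real" where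
  "mut_inf b P A B =
     prob_space.mutual_information (support_space P) b (range_space P A) (range_space P B) A B"

definition cond_mut_inf ::
  "real \<Rightarrow> 'w pmf \<Rightarrow> ('w \<Rightarrow> 'a) \<Rightarrow> ('w \<Rightarrow> 'b) \<Rightarrow> ('w \<Rightarrow> 'c) \<Rightarrow> real" where
  "cond_mut_inf b P A B C =
     prob_space.conditional_mutual_information (support_space P) b
       (range_space P A) (range_space P B) (range_space P C) A B C"


section \<open>Key agreement\<close>

definition rv_X :: "'x \<times> 'y \<times> 'z \<Rightarrow> 'x" where "rv_X = (\<lambda>(x, y, z). x)"
definition rv_Y :: "'x \<times> 'y \<times> 'z \<Rightarrow> 'y" where "rv_Y = (\<lambda>(x, y, z). y)"
definition rv_Z :: "'x \<times> 'y \<times> 'z \<Rightarrow> 'z" where "rv_Z = (\<lambda>(x, y, z). z)"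

text \<open>Finite message and key alphabets are, up to relabelling, finite sets of natural numbers.
  The message kernels take the own observation and the list of all previous messages; the length of
  that list determines the current round, so one kernel per party covers all of its rounds.\<close>

record ('x, 'y) protocol =
  rounds :: nat
  msg_alphabet :: "nat set"
  key_alphabet :: "nat set"
  alice_msg :: "'x list \<Rightarrow> nat list \<Rightarrow> nat pmf"
  bob_msg :: "'y list \<Rightarrow> nat list \<Rightarrow> nat pmf"
  alice_key :: "'x list \<Rightarrow> nat list \<Rightarrow> nat pmf"
  bob_key :: "'y list \<Rightarrow> nat list \<Rightarrow> nat pmf"

definition valid_protocol :: "('x, 'y) protocol \<Rightarrow> bool" where
  "valid_protocol \<pi> \<longleftrightarrow>
     finite (msg_alphabet \<pi>) \<and> finite (key_alphabet \<pi>) \<and>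
     (\<forall>x f. set_pmf (alice_msg \<pi> x f) \<subseteq> msg_alphabet \<pi>) \<and>
     (\<forall>y f. set_pmf (bob_msg \<pi> y f) \<subseteq> msg_alphabet \<pi>) \<and>
     (\<forall>x f. set_pmf (alice_key \<pi> x f) \<subseteq> key_alphabet \<pi>) \<and>
     (\<forall>y f. set_pmf (bob_key \<pi> y f) \<subseteq> key_alphabet \<pi>)"

text \<open>The conditional law of the first \<open>i\<close> messages in order of transmission. Round \<open>Suc i\<close> is odd,
  hence Alice's, exactly if \<open>i\<close> is even.\<close>

primrec transcript ::
  "('x, 'y) protocol \<Rightarrow> 'x list \<Rightarrow> 'y list \<Rightarrow> nat \<Rightarrow> nat list pmf" where
  "transcript \<pi> x y 0 = return_pmf []"
| "transcript \<pi> x y (Suc i) = do {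
     f \<leftarrow> transcript \<pi> x y i;
     m \<leftarrow> (if even i then alice_msg \<pi> x f else bob_msg \<pi> y f);
     return_pmf (f @ [m]) }"

text \<open>The joint law of \<open>((X\<^sup>n, Y\<^sup>n, Z\<^sup>n), F, K\<^sub>A, K\<^sub>B)\<close>.\<close>

definition protocol_law ::
  "('x \<times> 'y \<times> 'z) pmf \<Rightarrow> nat \<Rightarrow> ('x, 'y) protocol \<Rightarrow>
     (('x list \<times> 'y list \<times> 'z list) \<times> nat list \<times> nat \<times> nat) pmf" where
  "protocol_law P n \<pi> = do {
     w \<leftarrow> replicate_pmf n P;
     let x = map rv_X w;
     let y = map rv_Y w;
     let z = map rv_Z w;
     f \<leftarrow> transcript \<pi> x y (rounds \<pi>);
     kA \<leftarrow> alice_key \<pi> x f;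
     kB \<leftarrow> bob_key \<pi> y f;
     return_pmf ((x, y, z), f, kA, kB) }"

definition key_A :: "'s \<times> nat list \<times> nat \<times> nat \<Rightarrow> nat" where
  "key_A = (\<lambda>(s, f, kA, kB). kA)"

definition key_B :: "'s \<times> nat list \<times> nat \<times> nat \<Rightarrow> nat" where
  "key_B = (\<lambda>(s, f, kA, kB). kB)"

definition eve_view ::
  "('x list \<times> 'y list \<times> 'z list) \<times> nat list \<times> nat \<times> nat \<Rightarrow> 'z list \<times> nat list" where
  "eve_view = (\<lambda>((x, y, z), f, kA, kB). (z, f))"

definition is_code ::
  "real \<Rightarrow> ('x \<times> 'y \<times> 'z) pmf \<Rightarrow> nat \<Rightarrow> real \<Rightarrow> real \<Rightarrow> ('x, 'y) protocol \<Rightarrow> bool" where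
  "is_code b P n R \<delta> \<pi> \<longleftrightarrow>
     0 < n \<and> valid_protocol \<pi> \<and>
     R = ent b (protocol_law P n \<pi>) key_A / n \<and>
     measure_pmf.prob (protocol_law P n \<pi>) {\<omega>. key_A \<omega> = key_B \<omega>} \<ge> 1 - \<delta> \<and>
     R \<ge> log b (card (key_alphabet \<pi>)) / n - \<delta> \<and>
     mut_inf b (protocol_law P n \<pi>) key_A eve_view / n \<le> \<delta>"

definition achievable ::
  "real \<Rightarrow> ('x, 'y) protocol set \<Rightarrow> ('x \<times> 'y \<times> 'z) pmf \<Rightarrow> real \<Rightarrow> bool" where
  "achievable b \<C> P R \<longleftrightarrow> (\<forall>\<delta>>0. \<exists>n. \<exists>\<pi>\<in>\<C>. is_code b P n R \<delta> \<pi>)"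

text \<open>The supremum is taken in \<^typ>\<open>ereal\<close>, so that it is meaningful without a prior proof
  that the set of achievable rates is nonempty and bounded.\<close>

definition key_capacity ::
  "real \<Rightarrow> ('x, 'y) protocol set \<Rightarrow> ('x \<times> 'y \<times> 'z) pmf \<Rightarrow> ereal" where
  "key_capacity b \<C> P = (SUP R\<in>{R. achievable b \<C> P R}. ereal R)"

definition secret_key_capacity :: "real \<Rightarrow> ('x \<times> 'y \<times> 'z) pmf \<Rightarrow> ereal" where
  "secret_key_capacity b P = key_capacity b UNIV P"

text \<open>One-way communication: a single public message, sent by Alice.\<close>

definition one_way_secret_key_capacity :: "real \<Rightarrow> ('x \<times> 'y \<times> 'z) pmf \<Rightarrow> ereal" where
  "one_way_secret_key_capacity b P = key_capacity b {\<pi>. rounds \<pi> = 1} P"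


section \<open>The erasure source\<close>

text \<open>\<^const>\<open>None\<close> is the erasure symbol.\<close>

definition erasure_channel :: "real \<Rightarrow> 'x \<Rightarrow> 'x option pmf" where
  "erasure_channel \<epsilon> x = map_pmf (\<lambda>erased. if erased then None else Some x) (bernoulli_pmf \<epsilon>)"

definition erasure_source :: "'x pmf \<Rightarrow> ('x \<Rightarrow> 'z) \<Rightarrow> real \<Rightarrow> ('x \<times> 'x option \<times> 'z) pmf" where
  "erasure_source p g \<epsilon> = do {
     x \<leftarrow> p;
     y \<leftarrow> erasure_channel \<epsilon> x;
     return_pmf (x, y, g x) }"

end

theory Submission
  imports Defs "HOL-Real_Asymp.Real_Asymp"
begin

text \<open>Converse: compare the law of a protocol run with the run on a source in which Bob's letters are
  resampled given Eve's letters. The transcript and the keys are generated by the same kernels, so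
  the relative entropy is the \<open>n\<close>-letter conditional mutual information, and under the reference
  law the two keys are independent given Eve's view. Gibbs' inequality then bounds the equivocation
  of Alice's key by this information plus a Fano term, for any number of rounds at once.

  Achievability: Alice publishes \<open>z = g x\<close> letterwise, a bin index \<open>c x\<close>, and a uniform \<open>u\<close>, and her
  key is \<open>u + h x\<close> modulo \<open>M\<close>. If the index has rate slightly above \<open>\<epsilon> H(X|Z)\<close>, Bob decodes \<open>x\<close>.
  If \<open>(c, h)\<close> together have rate slightly above \<open>H(X|Z)\<close>, they almost determine \<open>x\<close> given \<open>z\<close>, so
  that \<open>H(h x | z, c x)\<close> is at least about \<open>n H(X|Z)\<close> minus the rate of \<open>c\<close>, which is the rate of the key.
  Weak secrecy therefore needs no separate privacy amplification.\<close>

text \<open>\<open>achievable\<close> fixes one \<open>R\<close> for all \<open>\<delta>\<close> and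
  asks for \<open>R = ent / n\<close> with equality, so a code whose rate is merely close to
  \<open>R\<close> does not count. Hence the key is made exactly uniform, and only rates
  \<open>a * log b 2 / k\<close> are targeted: for \<open>n\<close> a multiple of \<open>k\<close>,
  some power of two \<open>M\<close> has \<open>log b M = n * R\<close>. These rates are dense below
  the capacity, so the supremum is unaffected. The message rate is tied to \<open>R\<close> and not
  to \<open>\<epsilon> * H(X|Z)\<close>: the bins of \<open>c\<close> get what the key leaves of
  \<open>H(X|Z)\<close>, so that \<open>c\<close> and \<open>h\<close> together always exhaust it.
  For \<open>R\<close> up to the capacity this is also enough for Bob. In the converse Gibbs'
  inequality enters twice, once to replace the true law of the key given Eve's view by the reference
  one and once to compare the run with a tilted reference run. Both times a weight of total mass at
  most 1 suffices, so the reference run is never constructed as a pmf. Good bins come from a greedy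
  choice, and typicality is a threshold on the posterior weight combined with Chebyshev's
  inequality.\<close>

abbreviation expect :: "'w pmf \<Rightarrow> ('w \<Rightarrow> real) \<Rightarrow> real" where
  "expect \<equiv> measure_pmf.expectation"

section \<open>Finite expectations and Gibbs' inequality\<close>

lemma expect_sum:
  "finite (set_pmf Q) \<Longrightarrow> expect Q f = (\<Sum>w\<in>set_pmf Q. pmf Q w * f w)"
  by (subst integral_measure_pmf[of "set_pmf Q"]) auto

lemma expect_mono_pmf:
  assumes "finite (set_pmf Q)" "\<And>w. w \<in> set_pmf Q \<Longrightarrow> f w \<le> g w"
  shows "expect Q f \<le> expect Q g"
  using assms by (simp add: expect_sum sum_mono mult_left_mono)

lemma expect_cong_pmf:
  assumes "\<And>w. w \<in> set_pmf Q \<Longrightarrow> f w = g w"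
  shows "expect Q f = expect Q g"
  by (intro integral_cong_AE) (auto simp: assms AE_measure_pmf_iff)

lemma pmf_map_pos: "w \<in> set_pmf Q \<Longrightarrow> pmf (map_pmf A Q) (A w) > 0"
  by (metis imageI pmf_positive set_map_pmf)

text \<open>Averaging cancels the denominator, which leaves the \<open>r\<close>-mass of the values
  of \<open>A\<close>; the further points of \<open>S\<close> only add nonnegative terms.\<close>

lemma expect_pmf_ratio_le:
  assumes fin: "finite (set_pmf Q)"
    and r: "\<And>a. a \<in> A ` set_pmf Q \<Longrightarrow> r a \<ge> 0"
    and S: "finite S" "A ` set_pmf Q \<subseteq> S" "\<And>a. a \<in> S \<Longrightarrow> r a \<ge> 0"
  shows "expect Q (\<lambda>w. r (A w) / pmf (map_pmf A Q) (A w)) \<le> sum r S"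
proof -
  have "expect Q (\<lambda>w. r (A w) / pmf (map_pmf A Q) (A w))
      = expect (map_pmf A Q) (\<lambda>a. r a / pmf (map_pmf A Q) a)"
    by simp
  also have "\<dots> = (\<Sum>a\<in>A ` set_pmf Q. pmf (map_pmf A Q) a * (r a / pmf (map_pmf A Q) a))"
    using fin by (subst expect_sum) auto
  also have "\<dots> = (\<Sum>a\<in>A ` set_pmf Q. r a)"
    by (intro sum.cong) (auto dest: pmf_map_pos[of _ Q A])
  also have "\<dots> \<le> sum r S"
    using S by (intro sum_mono2) auto
  finally show ?thesis .
qed

text \<open>Gibbs' inequality for a weight \<open>r\<close> of mass at most 1 instead of a law: take
  expectations in \<open>ln t <= t - 1\<close> for the likelihood ratio \<open>t\<close>. Positivity
  of \<open>r\<close> on the support matters, since \<open>ln 0 = 0\<close> would violate that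
  bound.\<close>

lemma expect_log_pmf_ratio_le:
  assumes fin: "finite (set_pmf Q)" and b: "1 < b"
    and pos: "\<And>w. w \<in> set_pmf Q \<Longrightarrow> r (A w) > 0"
    and S: "finite S" "A ` set_pmf Q \<subseteq> S" "\<And>a. a \<in> S \<Longrightarrow> r a \<ge> 0" "sum r S \<le> 1"
  shows "expect Q (\<lambda>w. log b (r (A w) / pmf (map_pmf A Q) (A w))) \<le> 0"
proof -
  define t where "t w = r (A w) / pmf (map_pmf A Q) (A w)" for w
  have "log b (t w) \<le> (t w - 1) / ln b" if "w \<in> set_pmf Q" for w
  proof -
    have "t w > 0"
      unfolding t_def using pos[OF that] pmf_map_pos[OF that, of A] by simp
    hence "ln (t w) / ln b \<le> (t w - 1) / ln b"
      using b by (intro divide_right_mono ln_le_minus_one) auto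
    thus ?thesis by (simp only: log_def)
  qed
  hence "expect Q (\<lambda>w. log b (t w)) \<le> expect Q (\<lambda>w. (t w - 1) / ln b)"
    by (rule expect_mono_pmf[OF fin])
  also have "\<dots> = (expect Q t - 1) / ln b"
    using fin by (simp add: integrable_measure_pmf_finite)
  also have "expect Q t \<le> 1"
  proof -
    have "expect Q t \<le> sum r S"
      unfolding t_def by (rule expect_pmf_ratio_le[OF fin]) (use S in auto)
    thus ?thesis using S by simp
  qed
  hence "(expect Q t - 1) / ln b \<le> 0"
    using b by (simp add: divide_nonpos_pos)
  finally show ?thesis by (simp only: t_def)
qed

subsection \<open>Information quantities as expectations\<close>

lemma prob_space_support_space:
  assumes "finite (set_pmf Q)"
  shows "prob_space (support_space Q)"
proof
  show "emeasure (support_space Q) (space (support_space Q)) = 1"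
    unfolding support_space_def using assms
    by (simp add: space_point_measure emeasure_point_measure_finite sum_pmf_eq_1)
qed

lemma space_support_space [simp]: "space (support_space Q) = set_pmf Q"
  by (simp add: support_space_def space_point_measure)

text \<open>The bridge to the library formulas for discrete variables: on the support space every
  variable is simple, with the mass function of its image law.\<close>

lemma simple_distributed_support_space:
  assumes fin: "finite (set_pmf Q)"
  shows "simple_distributed (support_space Q) A (pmf (map_pmf A Q))"
proof (rule prob_space.simple_distributedI[OF prob_space_support_space[OF fin]])
  show "simple_function (support_space Q) A"
    using fin by (auto simp: simple_function_def support_space_def sets_point_measure space_point_measure)
next
  fix a assume "a \<in> A ` space (support_space Q)"
  have "measure (support_space Q) (A -` {a} \<inter> set_pmf Q) = sum (pmf Q) (A -` {a} \<inter> set_pmf Q)"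
    unfolding support_space_def using fin
    by (simp add: measure_def emeasure_point_measure_finite sum_nonneg)
  also have "\<dots> = pmf (map_pmf A Q) a"
    unfolding pmf_map using fin
    by (subst measure_Int_set_pmf[symmetric]) (simp add: measure_measure_pmf_finite)
  finally show "pmf (map_pmf A Q) a = measure (support_space Q) (A -` {a} \<inter> space (support_space Q))"
    by simp
qed simp

lemma sum_pmf_map_eq_expect:
  assumes fin: "finite (set_pmf Q)"
  shows "(\<Sum>a\<in>A ` set_pmf Q. pmf (map_pmf A Q) a * f a) = expect Q (\<lambda>w. f (A w))"
  using expect_sum[of "map_pmf A Q" f] fin by simp

context
  fixes b :: real and Q :: "'w pmf"
  assumes b: "1 < b" and fin: "finite (set_pmf Q)"
begin

lemma information_space_support_space: "information_space (support_space Q) b"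
  using b fin prob_space_support_space
  by (auto simp: information_space_def information_space_axioms_def)

lemma ent_eq_expect: "ent b Q A = expect Q (\<lambda>w. - log b (pmf (map_pmf A Q) (A w)))"
proof -
  interpret information_space "support_space Q" b
    by (rule information_space_support_space)
  show ?thesis
    using entropy_simple_distributed[OF simple_distributed_support_space[OF fin, of A]]
      sum_pmf_map_eq_expect[OF fin, of A "\<lambda>a. log b (pmf (map_pmf A Q) a)"]
    by (simp add: ent_def)
qed

lemma cond_ent_eq_expect:
  "cond_ent b Q A B = expect Q (\<lambda>w. - log b (pmf (map_pmf (\<lambda>w. (A w, B w)) Q) (A w, B w) /
     pmf (map_pmf B Q) (B w)))"
proof -
  interpret information_space "support_space Q" b
    by (rule information_space_support_space)
  note sd = simple_distributed_support_space[OF fin]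
  show ?thesis
    using conditional_entropy_eq[OF sd[of B] sd[of "\<lambda>w. (A w, B w)"]]
      sum_pmf_map_eq_expect[OF fin, of "\<lambda>w. (A w, B w)" "\<lambda>(x, y).
        log b (pmf (map_pmf (\<lambda>w. (A w, B w)) Q) (x, y) / pmf (map_pmf B Q) y)"]
    by (simp add: cond_ent_def case_prod_unfold)
qed

lemma cond_mut_inf_eq_expect:
  "cond_mut_inf b Q A B C = expect Q (\<lambda>w. log b (pmf (map_pmf (\<lambda>w. (A w, B w, C w)) Q) (A w, B w, C w) /
     (pmf (map_pmf (\<lambda>w. (A w, C w)) Q) (A w, C w) *
       (pmf (map_pmf (\<lambda>w. (B w, C w)) Q) (B w, C w) / pmf (map_pmf C Q) (C w)))))"
proof -
  interpret information_space "support_space Q" b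
    by (rule information_space_support_space)
  note sd = simple_distributed_support_space[OF fin]
  show ?thesis
    using conditional_mutual_information_eq[OF sd[of C] sd[of "\<lambda>w. (B w, C w)"] sd[of "\<lambda>w. (A w, C w)"]
        sd[of "\<lambda>w. (A w, B w, C w)"]]
      sum_pmf_map_eq_expect[OF fin, of "\<lambda>w. (A w, B w, C w)" "\<lambda>(x, y, z).
        log b (pmf (map_pmf (\<lambda>w. (A w, B w, C w)) Q) (x, y, z) /
         (pmf (map_pmf (\<lambda>w. (A w, C w)) Q) (x, z) *
       (pmf (map_pmf (\<lambda>w. (B w, C w)) Q) (y, z) / pmf (map_pmf C Q) z)))"]
    by (simp add: cond_mut_inf_def case_prod_unfold)
qed

text \<open>Turns the leakage condition on a code into one on the equivocation of the key. From here
  on only conditional entropies are estimated.\<close>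

lemma ent_minus_mut_inf: "ent b Q A - mut_inf b Q A B = cond_ent b Q A B"
proof -
  interpret information_space "support_space Q" b
    by (rule information_space_support_space)
  note sf = simple_distributed_simple_function[OF simple_distributed_support_space[OF fin]]
  from mutual_information_eq_entropy_conditional_entropy[OF sf[of A] sf[of B]]
  show ?thesis
    by (simp add: ent_def mut_inf_def cond_ent_def)
qed

text \<open>The cross-entropy bound: Gibbs' inequality for \<open>\<alpha> a c\<close> times the law
  of \<open>B\<close>. Guessing the conditional law of \<open>A\<close> by any
  \<open>\<alpha>\<close> costs at least the true conditional entropy. Each later upper bound on a
  conditional entropy is a choice of \<open>\<alpha>\<close>.\<close>

lemma cond_ent_le_expect:
  assumes K: "finite K" "A ` set_pmf Q \<subseteq> K"
    and pos: "\<And>w. w \<in> set_pmf Q \<Longrightarrow> \<alpha> (A w) (B w) > 0"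
    and nn: "\<And>a c. \<alpha> a c \<ge> 0" and le: "\<And>c. c \<in> B ` set_pmf Q \<Longrightarrow> (\<Sum>a\<in>K. \<alpha> a c) \<le> 1"
  shows "cond_ent b Q A B \<le> expect Q (\<lambda>w. - log b (\<alpha> (A w) (B w)))"
proof -
  let ?AB = "\<lambda>w. (A w, B w)" and ?S = "B ` set_pmf Q"
  define r where "r = (\<lambda>(a, c). \<alpha> a c * pmf (map_pmf B Q) c)"
  have "sum r (K \<times> ?S) = (\<Sum>c\<in>?S. \<Sum>a\<in>K. \<alpha> a c * pmf (map_pmf B Q) c)"
    unfolding r_def sum.cartesian_product[symmetric] by (rule sum.swap)
  also have "\<dots> = (\<Sum>c\<in>?S. (\<Sum>a\<in>K. \<alpha> a c) * pmf (map_pmf B Q) c)"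
    by (simp add: sum_distrib_right)
  also have "\<dots> \<le> (\<Sum>c\<in>?S. 1 * pmf (map_pmf B Q) c)"
    by (intro sum_mono mult_right_mono le) auto
  also have "\<dots> = 1"
    using fin by (simp add: sum_pmf_eq_1)
  finally have sum_r: "sum r (K \<times> ?S) \<le> 1" .
  have "expect Q (\<lambda>w. log b (r (?AB w) / pmf (map_pmf ?AB Q) (?AB w))) \<le> 0"
  proof (rule expect_log_pmf_ratio_le[OF fin b])
    show "r (?AB w) > 0" if "w \<in> set_pmf Q" for w
      using pos[OF that] pmf_map_pos[OF that, of B] by (simp add: r_def)
    show "finite (K \<times> ?S)" "?AB ` set_pmf Q \<subseteq> K \<times> ?S" using K fin by auto
    show "r a \<ge> 0" for a using nn by (auto simp: r_def split: prod.split)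
  qed (rule sum_r)
  also have "expect Q (\<lambda>w. log b (r (?AB w) / pmf (map_pmf ?AB Q) (?AB w)))
     = expect Q (\<lambda>w. - log b (pmf (map_pmf ?AB Q) (?AB w) / pmf (map_pmf B Q) (B w)) - - log b (\<alpha> (A w) (B w)))"
  proof (rule expect_cong_pmf)
    fix w assume w: "w \<in> set_pmf Q"
    from pos[OF w] pmf_map_pos[OF w, of B] pmf_map_pos[OF w, of ?AB]
    show "log b (r (?AB w) / pmf (map_pmf ?AB Q) (?AB w)) =
       - log b (pmf (map_pmf ?AB Q) (?AB w) / pmf (map_pmf B Q) (B w)) - - log b (\<alpha> (A w) (B w))"
      by (simp add: r_def log_mult_pos log_divide_pos b)
  qed
  also have "\<dots> = cond_ent b Q A B - expect Q (\<lambda>w. - log b (\<alpha> (A w) (B w)))"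
    unfolding cond_ent_eq_expect
    by (rule Bochner_Integration.integral_diff) (auto intro: integrable_measure_pmf_finite fin)
  finally show ?thesis by simp
qed

end

lemma cond_ent_map_pmf:
  assumes "1 < b" "finite (set_pmf Q)"
  shows "cond_ent b (map_pmf \<Phi> Q) A B = cond_ent b Q (\<lambda>w. A (\<Phi> w)) (\<lambda>w. B (\<Phi> w))"
  using assms by (simp add: cond_ent_eq_expect map_pmf_comp)

subsection \<open>The erasure source\<close>

lemma rv_simps [simp]: "rv_X (x, y, z) = x" "rv_Y (x, y, z) = y" "rv_Z (x, y, z) = z"
  by (simp_all add: rv_X_def rv_Y_def rv_Z_def)

definition posterior :: "'x pmf \<Rightarrow> ('x \<Rightarrow> 'z) \<Rightarrow> 'x \<Rightarrow> real" where
  "posterior p g x = pmf p x / pmf (map_pmf g p) (g x)"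

text \<open>This is H(X|Z), written in \<open>p\<close> and \<open>g\<close> alone so that it can be
  used without the channel; \<open>cond_ent_erasure_source\<close> makes the identification.\<close>

definition post_ent :: "real \<Rightarrow> 'x pmf \<Rightarrow> ('x \<Rightarrow> 'z) \<Rightarrow> real" where
  "post_ent b p g = expect p (\<lambda>x. - log b (posterior p g x))"

lemma posterior_pos: "x \<in> set_pmf p \<Longrightarrow> posterior p g x > 0"
  unfolding posterior_def using pmf_map_pos[of x p g] by (simp add: pmf_positive)

lemma posterior_nonneg: "posterior p g x \<ge> 0"
  by (simp add: posterior_def)

lemma sum_posterior_le:
  fixes p :: "'x::finite pmf"
  shows "(\<Sum>x | g x = z. posterior p g x) \<le> 1"
proof -
  have "(\<Sum>x | g x = z. posterior p g x) = (\<Sum>x | g x = z. pmf p x) / pmf (map_pmf g p) z"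
    by (simp add: posterior_def sum_divide_distrib)
  also have "(\<Sum>x | g x = z. pmf p x) = pmf (map_pmf g p) z"
    by (simp add: pmf_map measure_measure_pmf_finite vimage_def)
  finally show ?thesis by simp
qed

lemma post_ent_nonneg:
  fixes p :: "'x::finite pmf"
  assumes "1 < b"
  shows "post_ent b p g \<ge> 0"
  unfolding post_ent_def
proof (rule integral_nonneg_AE, unfold AE_measure_pmf_iff, safe)
  fix x assume x: "x \<in> set_pmf p"
  have "posterior p g x \<le> (\<Sum>x' | g x' = g x. posterior p g x')"
    by (intro member_le_sum) (auto simp: posterior_nonneg)
  also have "\<dots> \<le> 1" by (rule sum_posterior_le)
  finally show "0 \<le> - log b (posterior p g x)"
    using posterior_pos[OF x, of g] assms by simp
qed

lemma erasure_source_eq_map: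
  "erasure_source p g \<epsilon> = map_pmf (\<lambda>(x, e). (x, if e then None else Some x, g x))
     (pair_pmf p (bernoulli_pmf \<epsilon>))"
  by (simp add: erasure_source_def erasure_channel_def map_pmf_def pair_pmf_def
      bind_assoc_pmf bind_return_pmf)

lemma map_rv_X_erasure_source: "map_pmf rv_X (erasure_source p g \<epsilon>) = p"
proof -
  have "map_pmf rv_X (erasure_source p g \<epsilon>) = map_pmf fst (pair_pmf p (bernoulli_pmf \<epsilon>))"
    by (simp add: erasure_source_eq_map map_pmf_comp case_prod_unfold rv_X_def)
  thus ?thesis by (simp add: map_fst_pair_pmf)
qed

lemma set_erasure_source:
  "set_pmf (erasure_source p g \<epsilon>) \<subseteq> {(x, y, z). x \<in> set_pmf p \<and> z = g x \<and> (y = None \<or> y = Some x)}"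
  by (auto simp: erasure_source_eq_map split: if_splits)

lemma map_erasure_source_fun_X:
  assumes "\<And>x y. f (x, y, g x) = f' x"
  shows "map_pmf f (erasure_source p g \<epsilon>) = map_pmf f' p"
proof -
  have "map_pmf f (erasure_source p g \<epsilon>) = map_pmf (f' \<circ> rv_X) (erasure_source p g \<epsilon>)"
    using set_erasure_source[of p g \<epsilon>] by (intro map_pmf_cong) (auto simp: assms)
  thus ?thesis by (simp add: map_rv_X_erasure_source flip: pmf.map_comp)
qed

context
  fixes \<epsilon> :: real
  assumes \<epsilon>: "0 \<le> \<epsilon>" "\<epsilon> \<le> 1"
begin

lemma expect_erasure_source:
  fixes p :: "'x::finite pmf"
  shows "expect (erasure_source p g \<epsilon>) f
     = expect p (\<lambda>x. \<epsilon> * f (x, None, g x) + (1 - \<epsilon>) * f (x, Some x, g x))"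
proof -
  have "expect (erasure_source p g \<epsilon>) f = (\<Sum>x\<in>UNIV. pmf p x *\<^sub>R
     expect (erasure_channel \<epsilon> x \<bind> (\<lambda>y. return_pmf (x, y, g x))) f)"
    unfolding erasure_source_def
    by (rule pmf_expectation_bind) (auto simp: erasure_channel_def)
  also have "(\<lambda>x. expect (erasure_channel \<epsilon> x \<bind> (\<lambda>y. return_pmf (x, y, g x))) f) =
     (\<lambda>x. \<epsilon> * f (x, None, g x) + (1 - \<epsilon>) * f (x, Some x, g x))"
    using \<epsilon> by (simp add: erasure_channel_def bind_map_pmf fun_eq_iff flip: map_pmf_def)
  finally show ?thesis
    by (subst integral_measure_pmf[of UNIV]) auto
qed

lemma pmf_erasure_source:
  fixes p :: "'x::finite pmf"
  shows "pmf (erasure_source p g \<epsilon>) (x, y, z) =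
     (if z = g x then pmf p x * (case y of None \<Rightarrow> \<epsilon> | Some x' \<Rightarrow> (1 - \<epsilon>) * of_bool (x' = x)) else 0)"
proof -
  have "pmf (erasure_source p g \<epsilon>) (x, y, z) = expect (erasure_source p g \<epsilon>) (indicator {(x, y, z)})"
    by (simp add: pmf.rep_eq)
  also have "\<dots> = (\<Sum>x'\<in>UNIV. pmf p x' * (\<epsilon> * indicator {(x, y, z)} (x', None, g x')
      + (1 - \<epsilon>) * indicator {(x, y, z)} (x', Some x', g x')))"
    unfolding expect_erasure_source by (subst integral_measure_pmf[of UNIV]) auto
  also have "\<dots> = (\<Sum>x'\<in>UNIV. if x' = x then pmf p x * (if z = g x then 
       (case y of None \<Rightarrow> \<epsilon> | Some x' \<Rightarrow> (1 - \<epsilon>) * of_bool (x' = x)) else 0) else 0)"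
    by (intro sum.cong) (auto simp: indicator_def split: option.splits)
  finally show ?thesis by simp
qed

lemma cond_ent_erasure_source:
  fixes p :: "'x::finite pmf" and g :: "'x \<Rightarrow> 'z::finite"
  assumes b: "1 < b"
  shows "cond_ent b (erasure_source p g \<epsilon>) rv_X rv_Z = post_ent b p g"
proof -
  have fin: "finite (set_pmf (erasure_source p g \<epsilon>))"
    by (rule finite)
  have XZ: "map_pmf (\<lambda>w. (rv_X w, rv_Z w)) (erasure_source p g \<epsilon>) = map_pmf (\<lambda>x. (x, g x)) p"
    by (rule map_erasure_source_fun_X) simp
  have Z: "map_pmf rv_Z (erasure_source p g \<epsilon>) = map_pmf g p"
    by (rule map_erasure_source_fun_X) simp
  have eq: "pmf (map_pmf (\<lambda>x. (x, g x)) p) (x, g x) = pmf p x" for x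
    using pmf_map_inj'[of "\<lambda>x. (x, g x)" p x] by (simp add: inj_on_def)
  show ?thesis
    unfolding cond_ent_eq_expect[OF b fin] XZ Z post_ent_def posterior_def expect_erasure_source
    by (simp add: eq algebra_simps)
qed

text \<open>The information density vanishes on an erasure, which is independent of \<open>X\<close>
  given \<open>Z\<close>, and equals \<open>- log b (posterior p g x)\<close> when the letter
  arrives, which has weight \<open>1 - \<epsilon>\<close>.\<close>

lemma cond_mut_inf_erasure_source:
  fixes p :: "'x::finite pmf" and g :: "'x \<Rightarrow> 'z::finite"
  assumes b: "1 < b"
  shows "cond_mut_inf b (erasure_source p g \<epsilon>) rv_X rv_Y rv_Z = (1 - \<epsilon>) * post_ent b p g"
proof -
  let ?P = "erasure_source p g \<epsilon>"
  have fin: "finite (set_pmf ?P)"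
    by (rule finite)
  have XYZ: "map_pmf (\<lambda>w. (rv_X w, rv_Y w, rv_Z w)) ?P = ?P"
    by (simp add: rv_X_def rv_Y_def rv_Z_def case_prod_unfold)
  have XZ: "map_pmf (\<lambda>w. (rv_X w, rv_Z w)) ?P = map_pmf (\<lambda>x. (x, g x)) p"
    by (rule map_erasure_source_fun_X) simp
  have Z: "map_pmf rv_Z ?P = map_pmf g p"
    by (rule map_erasure_source_fun_X) simp
  have eq: "pmf (map_pmf (\<lambda>x. (x, g x)) p) (x, g x) = pmf p x" for x
    using pmf_map_inj'[of "\<lambda>x. (x, g x)" p x] by (simp add: inj_on_def)
  have "pmf (map_pmf (\<lambda>w. (rv_Y w, rv_Z w)) ?P) (y, z) = expect ?P (\<lambda>w. indicator {(y, z)} (rv_Y w, rv_Z w))" for y z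
  proof -
    have "pmf (map_pmf (\<lambda>w. (rv_Y w, rv_Z w)) ?P) (y, z)
      = expect (map_pmf (\<lambda>w. (rv_Y w, rv_Z w)) ?P) (indicator {(y, z)})"
      by (simp only: pmf.rep_eq) (simp del: integral_map_pmf measure_map_pmf)
    thus ?thesis by (simp only: integral_map_pmf)
  qed
  hence YZ: "pmf (map_pmf (\<lambda>w. (rv_Y w, rv_Z w)) ?P) (y, z)
      = (\<Sum>x'\<in>UNIV. pmf p x' * (\<epsilon> * of_bool (y = None \<and> z = g x') + (1 - \<epsilon>) * of_bool (y = Some x' \<and> z = g x')))" for y z
    unfolding expect_erasure_source
    by (subst (asm) integral_measure_pmf[of UNIV])
       (auto simp: indicator_def of_bool_def intro!: sum.cong)
  have YZ_None: "pmf (map_pmf (\<lambda>w. (rv_Y w, rv_Z w)) ?P) (None, z) = \<epsilon> * pmf (map_pmf g p) z" for z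
  proof -
    have "(\<Sum>x'\<in>UNIV. pmf p x' * (\<epsilon> * of_bool (z = g x'))) = \<epsilon> * (\<Sum>x'\<in>UNIV. if g x' = z then pmf p x' else 0)"
      unfolding sum_distrib_left by (intro sum.cong) auto
    also have "(\<Sum>x'\<in>UNIV. if g x' = z then pmf p x' else 0) = pmf (map_pmf g p) z"
      by (simp add: pmf_map measure_measure_pmf_finite vimage_def sum.If_cases)
    finally show ?thesis unfolding YZ by simp
  qed
  have YZ_Some: "pmf (map_pmf (\<lambda>w. (rv_Y w, rv_Z w)) ?P) (Some x, g x) = (1 - \<epsilon>) * pmf p x" for x
  proof -
    have "(\<Sum>x'\<in>UNIV. pmf p x' * ((1 - \<epsilon>) * of_bool (x = x' \<and> g x = g x')))
      = (\<Sum>x'\<in>UNIV. if x' = x then (1 - \<epsilon>) * pmf p x else 0)"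
      by (intro sum.cong) auto
    thus ?thesis unfolding YZ by simp
  qed
  show ?thesis
    unfolding cond_mut_inf_eq_expect[OF b fin] XYZ XZ Z post_ent_def posterior_def expect_erasure_source
      integral_mult_right_zero[symmetric]
  proof (rule expect_cong_pmf, goal_cases)
    case (1 x)
    let ?q = "map_pmf (\<lambda>w. (rv_Y w, rv_Z w)) ?P"
    have pos: "pmf p x > 0" "pmf (map_pmf g p) (g x) > 0"
      using 1 by (auto simp: pmf_positive pmf_map_pos)
    \<comment> \<open>For \<open>\<epsilon> = 0\<close> the argument of the logarithm degenerates to
      a division by 0, but the whole term carries the weight 0; likewise for
      \<open>\<epsilon> = 1\<close> in the other branch.\<close>
    have "\<epsilon> * log b (pmf ?P (x, None, g x) / (pmf p x * (pmf ?q (None, g x) / pmf (map_pmf g p) (g x)))) = 0"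
      unfolding YZ_None pmf_erasure_source using pos by (cases "\<epsilon> = 0") simp_all
    moreover have "(1 - \<epsilon>) * log b (pmf ?P (x, Some x, g x) /
        (pmf p x * (pmf ?q (Some x, g x) / pmf (map_pmf g p) (g x))))
      = (1 - \<epsilon>) * - log b (pmf p x / pmf (map_pmf g p) (g x))"
      unfolding YZ_Some pmf_erasure_source using pos b
      by (cases "\<epsilon> = 1") (simp_all add: log_divide_pos)
    ultimately show ?case
      by (simp only: rv_simps eq)
  qed
qed

end

subsection \<open>Blocks of letters\<close>

text \<open>If the outcome records both stages of an experiment, a single intermediate value
  contributes to it, so the probability is a plain product. The instances are \<open>Pair\<close>,
  \<open>Cons\<close> and appending a message to a transcript.\<close>

lemma pmf_bind_map_inj:
  assumes "\<And>x m x' m'. e x m = e x' m' \<longleftrightarrow> x = x' \<and> m = m'"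
  shows "pmf (T \<bind> (\<lambda>x. map_pmf (e x) (K x))) (e x m) = pmf T x * pmf (K x) m"
proof -
  have *: "pmf (map_pmf (e x') (K x')) (e x m) = indicator {x} x' * pmf (K x) m" for x'
  proof (cases "x' = x")
    case True
    then show ?thesis using pmf_map_inj'[of "e x" "K x" m] assms by (simp add: inj_on_def)
  next
    case False
    then show ?thesis using assms by (auto simp: pmf_eq_0_set_pmf)
  qed
  show ?thesis
    unfolding pmf_bind * by (simp add: measure_pmf_single)
qed

lemmas pmf_bind_Pair = pmf_bind_map_inj[of Pair, simplified]

lemma pmf_replicate_pmf:
  "length xs = n \<Longrightarrow> pmf (replicate_pmf n p) xs = (\<Prod>i<n. pmf p (xs ! i))"
proof (induction n arbitrary: xs)
  case (Suc n)
  then obtain y ys where xs: "xs = y # ys" "length ys = n"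
    by (cases xs) auto
  have "pmf (replicate_pmf (Suc n) p) xs = pmf p y * pmf (replicate_pmf n p) ys"
    using pmf_bind_map_inj[of Cons p "\<lambda>_. replicate_pmf n p" y ys]
    by (simp add: xs map_pmf_def)
  then show ?case
    using Suc.IH[OF xs(2)] by (simp add: xs prod.lessThan_Suc_shift del: prod.lessThan_Suc)
qed simp

lemma map_replicate_pmf: "map_pmf (map f) (replicate_pmf n p) = replicate_pmf n (map_pmf f p)"
proof (induction n)
  case (Suc n)
  have "map_pmf (map f) (replicate_pmf (Suc n) p) =
      p \<bind> (\<lambda>x. map_pmf (map f) (replicate_pmf n p) \<bind> (\<lambda>xs. return_pmf (f x # xs)))"
    by (simp add: map_bind_pmf bind_map_pmf)
  then show ?case
    by (simp add: Suc.IH bind_map_pmf)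
qed simp

lemma finite_set_replicate_pmf: "finite (set_pmf p) \<Longrightarrow> finite (set_pmf (replicate_pmf n p))"
  unfolding set_replicate_pmf lists_eq_set
  using finite_lists_length_eq[of "set_pmf p" n] by simp

lemma length_replicate_pmf: "w \<in> set_pmf (replicate_pmf n p) \<Longrightarrow> length w = n"
  by (simp add: set_replicate_pmf)

lemma expect_bind_pmf:
  assumes "finite (set_pmf p)" "\<And>x. x \<in> set_pmf p \<Longrightarrow> finite (set_pmf (f x))"
  shows "expect (p \<bind> f) h = expect p (\<lambda>x. expect (f x) h)"
  using pmf_expectation_bind[of "set_pmf p" f p h] assms by (simp add: expect_sum)

lemma expect_replicate_pmf_Suc:
  assumes "finite (set_pmf p)"
  shows "expect (replicate_pmf (Suc n) p) h = expect p (\<lambda>x. expect (replicate_pmf n p) (\<lambda>xs. h (x # xs)))"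
  using assms by (simp add: expect_bind_pmf finite_set_replicate_pmf)

lemma expect_replicate_pmf_sum:
  assumes "finite (set_pmf p)"
  shows "expect (replicate_pmf n p) (\<lambda>w. \<Sum>x\<leftarrow>w. f x) = n * expect p f"
proof (induction n)
  case (Suc n)
  show ?case
    unfolding expect_replicate_pmf_Suc[OF assms]
    using assms Suc.IH
    by (simp add: integrable_measure_pmf_finite finite_set_replicate_pmf algebra_simps)
qed simp

lemma lists_length_Suc: "{xs. length xs = Suc n} = (\<lambda>(x, xs). x # xs) ` (UNIV \<times> {xs. length xs = n})"
  by (auto simp: length_Suc_conv image_iff)

lemma finite_lists_length: "finite {xs :: 'a::finite list. length xs = n}"
  using finite_lists_length_eq[of "UNIV :: 'a set" n] by simp

text \<open>The sum of products factorises over the positions. The weight may vary with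
  \<open>i\<close> because it will be taken given the letters that other parties see at position
  \<open>i\<close>.\<close>

lemma sum_lists_prod_le:
  fixes k :: "nat \<Rightarrow> 'a::finite \<Rightarrow> real"
  assumes "\<And>i x. i < n \<Longrightarrow> k i x \<ge> 0" "\<And>i. i < n \<Longrightarrow> (\<Sum>x\<in>UNIV. k i x) \<le> 1"
  shows "(\<Sum>xs | length xs = n. \<Prod>i<n. k i (xs ! i)) \<le> 1"
  using assms
proof (induction n arbitrary: k)
  case (Suc n)
  have "(\<Sum>xs | length xs = Suc n. \<Prod>i<Suc n. k i (xs ! i))
      = (\<Sum>(x, xs)\<in>UNIV \<times> {xs. length xs = n}. k 0 x * (\<Prod>i<n. k (Suc i) (xs ! i)))"
    unfolding lists_length_Suc
    by (subst sum.reindex) (auto simp: inj_on_def prod.lessThan_Suc_shift case_prod_unfold simp del: prod.lessThan_Suc)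
  also have "\<dots> = (\<Sum>x\<in>UNIV. k 0 x) * (\<Sum>xs | length xs = n. \<Prod>i<n. k (Suc i) (xs ! i))"
    by (simp add: sum_product sum.cartesian_product)
  also have "\<dots> \<le> 1 * 1"
    using Suc.prems by (intro mult_mono Suc.IH sum_nonneg prod_nonneg) auto
  finally show ?case by simp
qed simp

definition erasure_prob :: "real \<Rightarrow> 'x \<Rightarrow> 'x option \<Rightarrow> real" where
  "erasure_prob \<epsilon> x y = (case y of None \<Rightarrow> \<epsilon> | Some x' \<Rightarrow> (1 - \<epsilon>) * of_bool (x' = x))"

text \<open>Eve's block is left out because it is \<open>map g\<close> of Alice's;
  \<open>protocol_law_eq_map\<close> puts it back.\<close>

definition erasure_block ::
  "nat \<Rightarrow> 'x pmf \<Rightarrow> ('x \<Rightarrow> 'z) \<Rightarrow> real \<Rightarrow> ('x list \<times> 'x option list) pmf" where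
  "erasure_block n p g \<epsilon> =
     map_pmf (\<lambda>w. (map rv_X w, map rv_Y w)) (replicate_pmf n (erasure_source p g \<epsilon>))"

lemma map_rv_Z_source_block:
  assumes "w \<in> set_pmf (replicate_pmf n (erasure_source p g \<epsilon>))"
  shows "map rv_Z w = map g (map rv_X w)"
  using assms set_erasure_source[of p g \<epsilon>]
  by (fastforce simp: set_replicate_pmf rv_X_def rv_Z_def in_lists_conv_set)

lemma map_fst_erasure_block: "map_pmf fst (erasure_block n p g \<epsilon>) = replicate_pmf n p"
  by (simp add: erasure_block_def map_pmf_comp map_replicate_pmf map_rv_X_erasure_source)

lemma length_erasure_block:
  "(x, y) \<in> set_pmf (erasure_block n p g \<epsilon>) \<Longrightarrow> length x = n \<and> length y = n"
  by (auto simp: erasure_block_def length_replicate_pmf)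

lemma finite_erasure_block:
  fixes p :: "'x::finite pmf" and g :: "'x \<Rightarrow> 'z::finite"
  shows "finite (set_pmf (erasure_block n p g \<epsilon>))"
  by (simp add: erasure_block_def finite_set_replicate_pmf)

lemma expect_erasure_block_sum:
  fixes p :: "'x::finite pmf" and g :: "'x \<Rightarrow> 'z::finite"
  assumes \<epsilon>: "0 \<le> \<epsilon>" "\<epsilon> \<le> 1"
  shows "expect (erasure_block n p g \<epsilon>) (\<lambda>(x, y). \<Sum>i<n. f (x ! i) (y ! i))
     = n * expect p (\<lambda>x. \<epsilon> * f x None + (1 - \<epsilon>) * f x (Some x))"
proof -
  let ?f = "\<lambda>w. f (rv_X w) (rv_Y w)"
  have "expect (erasure_block n p g \<epsilon>) (\<lambda>(x, y). \<Sum>i<n. f (x ! i) (y ! i))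
    = expect (replicate_pmf n (erasure_source p g \<epsilon>)) (\<lambda>w. \<Sum>i<n. f (map rv_X w ! i) (map rv_Y w ! i))"
    by (simp add: erasure_block_def)
  also have "\<dots> = expect (replicate_pmf n (erasure_source p g \<epsilon>)) (\<lambda>w. \<Sum>v\<leftarrow>w. ?f v)"
    by (intro expect_cong_pmf)
       (auto simp: sum_list_sum_nth atLeast0LessThan length_replicate_pmf)
  also have "\<dots> = n * expect (erasure_source p g \<epsilon>) ?f"
    by (rule expect_replicate_pmf_sum) simp
  finally show ?thesis
    by (simp add: expect_erasure_source[OF \<epsilon>] rv_X_def rv_Y_def)
qed

lemma pmf_erasure_block:
  fixes p :: "'x::finite pmf"
  assumes \<epsilon>: "0 \<le> \<epsilon>" "\<epsilon> \<le> 1" and len: "length x = n" "length y = n"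
  shows "pmf (erasure_block n p g \<epsilon>) (x, y) = (\<Prod>i<n. pmf p (x ! i) * erasure_prob \<epsilon> (x ! i) (y ! i))"
proof -
  let ?f = "\<lambda>w. (map fst w, map snd w) :: 'x list \<times> 'x option list"
  have letter: "pmf (map_pmf (\<lambda>w. (rv_X w, rv_Y w)) (erasure_source p g \<epsilon>)) (x, y)
      = pmf p x * erasure_prob \<epsilon> x y" for x y
  proof -
    have "pmf (map_pmf (\<lambda>w. (rv_X w, rv_Y w)) (erasure_source p g \<epsilon>)) (x, y)
       = measure (erasure_source p g \<epsilon>) ({(x, y, g x)} \<inter> set_pmf (erasure_source p g \<epsilon>))"
      unfolding pmf_map using set_erasure_source[of p g \<epsilon>]
      by (subst measure_Int_set_pmf[symmetric], intro arg_cong[of _ _ "measure _"])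
         (auto simp: rv_X_def rv_Y_def)
    also have "\<dots> = pmf (erasure_source p g \<epsilon>) (x, y, g x)"
      by (simp only: measure_Int_set_pmf measure_pmf_single)
    finally show ?thesis
      by (simp add: pmf_erasure_source[OF \<epsilon>] erasure_prob_def)
  qed
  have block: "erasure_block n p g \<epsilon>
      = map_pmf ?f (map_pmf (map (\<lambda>w. (rv_X w, rv_Y w))) (replicate_pmf n (erasure_source p g \<epsilon>)))"
    by (simp add: erasure_block_def map_pmf_comp comp_def)
  have inj: "inj ?f"
    by (rule injI) (metis Pair_inject zip_map_fst_snd)
  have xy: "(x, y) = ?f (zip x y)"
    using len by simp
  have "pmf (erasure_block n p g \<epsilon>) (x, y) =
     pmf (replicate_pmf n (map_pmf (\<lambda>w. (rv_X w, rv_Y w)) (erasure_source p g \<epsilon>))) (zip x y)"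
    unfolding block map_replicate_pmf by (subst xy) (rule pmf_map_inj'[OF inj])
  also have "\<dots> = (\<Prod>i<n. pmf p (x ! i) * erasure_prob \<epsilon> (x ! i) (y ! i))"
    using len by (subst pmf_replicate_pmf) (auto simp: letter intro!: prod.cong)
  finally show ?thesis .
qed

subsection \<open>The law of a protocol\<close>

text \<open>Alice's half of the transcript probability, with Bob's rounds counted as 1. That this
  half does not involve \<open>y\<close> is what the converse rests on. Positions count from 0, so
  her rounds are the even ones.\<close>

definition alice_weight :: "('x, 'y) protocol \<Rightarrow> 'x list \<Rightarrow> nat list \<Rightarrow> real" where
  "alice_weight \<pi> x f = (\<Prod>i<length f. if even i then pmf (alice_msg \<pi> x (take i f)) (f ! i) else 1)"

definition bob_weight :: "('x, 'y) protocol \<Rightarrow> 'y list \<Rightarrow> nat list \<Rightarrow> real" where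
  "bob_weight \<pi> y f = (\<Prod>i<length f. if even i then 1 else pmf (bob_msg \<pi> y (take i f)) (f ! i))"

lemma pmf_transcript:
  "length f = r \<Longrightarrow> pmf (transcript \<pi> x y r) f = alice_weight \<pi> x f * bob_weight \<pi> y f"
proof (induction r arbitrary: f)
  case 0
  then show ?case by (simp add: alice_weight_def bob_weight_def)
next
  case (Suc r)
  then obtain f' m where f: "f = f' @ [m]" "length f' = r"
    by (metis length_Suc_conv_rev)
  let ?K = "\<lambda>f. if even r then alice_msg \<pi> x f else bob_msg \<pi> y f"
  have "pmf (transcript \<pi> x y (Suc r)) f = pmf (transcript \<pi> x y r) f' * pmf (?K f') m"
    using pmf_bind_map_inj[of "\<lambda>f m. f @ [m]" "transcript \<pi> x y r" ?K f' m]
    by (simp add: f map_pmf_def)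
  moreover have "(\<Prod>i<r. if even i then pmf (alice_msg \<pi> x (take i (f' @ [m]))) ((f' @ [m]) ! i) else 1)
      = alice_weight \<pi> x f'"
    unfolding alice_weight_def f by (intro prod.cong) (auto simp: nth_append f)
  moreover have "(\<Prod>i<r. if even i then 1 else pmf (bob_msg \<pi> y (take i (f' @ [m]))) ((f' @ [m]) ! i))
      = bob_weight \<pi> y f'"
    unfolding bob_weight_def f by (intro prod.cong) (auto simp: nth_append f)
  ultimately show ?case
    by (auto simp: Suc.IH f nth_append alice_weight_def[of _ _ "f' @ [m]"] bob_weight_def[of _ _ "f' @ [m]"])
qed

lemma set_transcript:
  assumes "valid_protocol \<pi>" "f \<in> set_pmf (transcript \<pi> x y r)"
  shows "set f \<subseteq> msg_alphabet \<pi> \<and> length f = r"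
  using assms(2)
proof (induction r arbitrary: f)
  case (Suc r)
  then obtain f' m where f: "f = f' @ [m]" "f' \<in> set_pmf (transcript \<pi> x y r)"
    and m: "m \<in> set_pmf (if even r then alice_msg \<pi> x f' else bob_msg \<pi> y f')"
    by auto
  have "set_pmf (if even r then alice_msg \<pi> x f' else bob_msg \<pi> y f') \<subseteq> msg_alphabet \<pi>"
    using assms(1) by (simp add: valid_protocol_def)
  hence "m \<in> msg_alphabet \<pi>"
    using m by blast
  then show ?case
    using Suc.IH[OF f(2)] f(1) by simp
qed simp

text \<open>Every intermediate value stays in the outcome, so that \<open>pmf_bind_Pair\<close>
  yields the probability as a product of the kernels.\<close>

definition run_law :: "('x list \<times> 'y list) pmf \<Rightarrow> ('x, 'y) protocol \<Rightarrow>
    (('x list \<times> 'y list) \<times> nat list \<times> nat \<times> nat) pmf" where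
  "run_law D \<pi> = D \<bind> (\<lambda>s. map_pmf (Pair s) (transcript \<pi> (fst s) (snd s) (rounds \<pi>) \<bind>
     (\<lambda>f. map_pmf (Pair f) (pair_pmf (alice_key \<pi> (fst s) f) (bob_key \<pi> (snd s) f)))))"

lemma pmf_run_law:
  "pmf (run_law D \<pi>) (s, f, a, b) = pmf D s * (pmf (transcript \<pi> (fst s) (snd s) (rounds \<pi>)) f *
     (pmf (alice_key \<pi> (fst s) f) a * pmf (bob_key \<pi> (snd s) f) b))"
  unfolding run_law_def by (simp only: pmf_bind_Pair pmf_pair)

lemma map_fst_run_law: "map_pmf fst (run_law D \<pi>) = D"
  by (simp add: run_law_def map_bind_pmf map_pmf_comp bind_return_pmf')

lemma set_run_law:
  assumes "valid_protocol \<pi>" "(s, f, a, b) \<in> set_pmf (run_law D \<pi>)"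
  shows "s \<in> set_pmf D" "set f \<subseteq> msg_alphabet \<pi>" "length f = rounds \<pi>"
    "a \<in> key_alphabet \<pi>" "b \<in> key_alphabet \<pi>"
proof -
  have s: "s \<in> set_pmf D" "f \<in> set_pmf (transcript \<pi> (fst s) (snd s) (rounds \<pi>))"
    and ab: "a \<in> set_pmf (alice_key \<pi> (fst s) f)" "b \<in> set_pmf (bob_key \<pi> (snd s) f)"
    using assms(2) by (auto simp: run_law_def)
  show "s \<in> set_pmf D" by (rule s)
  show "set f \<subseteq> msg_alphabet \<pi>" "length f = rounds \<pi>"
    using set_transcript[OF assms(1) s(2)] by auto
  show "a \<in> key_alphabet \<pi>" "b \<in> key_alphabet \<pi>"
    using assms(1) ab unfolding valid_protocol_def by blast+
qed

lemma finite_run_law: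
  assumes "valid_protocol \<pi>" "finite (set_pmf D)"
  shows "finite (set_pmf (run_law D \<pi>))"
proof (rule finite_subset)
  show "set_pmf (run_law D \<pi>) \<subseteq> set_pmf D \<times> {f. set f \<subseteq> msg_alphabet \<pi> \<and> length f = rounds \<pi>} \<times>
     key_alphabet \<pi> \<times> key_alphabet \<pi>"
    by (clarsimp simp del: mem_Sigma_iff) (simp add: set_run_law[OF assms(1)])
  show "finite \<dots>"
    using assms by (intro finite_cartesian_product finite_lists_length_eq) (auto simp: valid_protocol_def)
qed

lemma protocol_law_eq_map:
  "protocol_law (erasure_source p g \<epsilon>) n \<pi> =
     map_pmf (\<lambda>((x, y), f, a, b). ((x, y, map g x), f, a, b)) (run_law (erasure_block n p g \<epsilon>) \<pi>)"
proof -
  have "protocol_law (erasure_source p g \<epsilon>) n \<pi> = 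
     replicate_pmf n (erasure_source p g \<epsilon>) \<bind> (\<lambda>w.
       transcript \<pi> (map rv_X w) (map rv_Y w) (rounds \<pi>) \<bind> (\<lambda>f.
       alice_key \<pi> (map rv_X w) f \<bind> (\<lambda>kA. bob_key \<pi> (map rv_Y w) f \<bind> (\<lambda>kB.
       return_pmf ((map rv_X w, map rv_Y w, map g (map rv_X w)), f, kA, kB)))))"
    unfolding protocol_law_def Let_def
    by (intro bind_pmf_cong refl) (simp add: map_rv_Z_source_block)
  also have "\<dots> = map_pmf (\<lambda>((x, y), f, a, b). ((x, y, map g x), f, a, b)) (run_law (erasure_block n p g \<epsilon>) \<pi>)"
    by (simp add: run_law_def erasure_block_def map_bind_pmf bind_map_pmf map_pmf_comp pair_pmf_def
      map_pmf_def[of _ "return_pmf _"] bind_assoc_pmf bind_return_pmf)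
  finally show ?thesis .
qed

subsection \<open>The converse\<close>

text \<open>Under a law that makes the two observations conditionally independent given \<open>z\<close>, the
  transcript keeps them independent because its conditional probability is a product of a weight
  of Alice and a weight of Bob. So does the pair of keys, and Bob's key cannot help to guess
  Alice's.\<close>

lemma sum_decoupled_guess_le:
  fixes \<mu> :: "'x \<Rightarrow> real" and \<nu> :: "'z \<Rightarrow> 'y \<Rightarrow> real" and wa :: "'x \<Rightarrow> 'f \<Rightarrow> real" and wb :: "'y \<Rightarrow> 'f \<Rightarrow> real"
    and ka :: "'x \<Rightarrow> 'f \<Rightarrow> 'k \<Rightarrow> real" and kb :: "'y \<Rightarrow> 'f \<Rightarrow> 'k \<Rightarrow> real" and \<phi> :: "'k \<Rightarrow> 'k \<Rightarrow> real" and G :: "'x \<Rightarrow> 'z"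
  assumes fin: "finite X" "finite Y" "finite F" "finite K"
    and nn: "\<And>x. \<mu> x \<ge> 0" "\<And>z y. \<nu> z y \<ge> 0" "\<And>x f. wa x f \<ge> 0" "\<And>y f. wb y f \<ge> 0"
      "\<And>x f a. ka x f a \<ge> 0" "\<And>y f b. kb y f b \<ge> 0" "\<And>a b. \<phi> a b \<ge> 0"
    and \<mu>: "sum \<mu> X \<le> 1" and \<nu>: "\<And>z. sum (\<nu> z) Y \<le> 1"
    and w: "\<And>x y. x \<in> X \<Longrightarrow> y \<in> Y \<Longrightarrow> (\<Sum>f\<in>F. wa x f * wb y f) \<le> 1"
    and kb: "\<And>y f. sum (kb y f) K \<le> 1" and \<phi>: "\<And>b. b \<in> K \<Longrightarrow> (\<Sum>a\<in>K. \<phi> a b) \<le> 1"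
  defines "a0 \<equiv> \<lambda>z f. \<Sum>x\<in>{x\<in>X. G x = z}. \<mu> x * wa x f"
    and "a1 \<equiv> \<lambda>z f a. \<Sum>x\<in>{x\<in>X. G x = z}. \<mu> x * wa x f * ka x f a"
  shows "(\<Sum>x\<in>X. \<Sum>y\<in>Y. \<Sum>f\<in>F. \<Sum>a\<in>K. \<Sum>b\<in>K. \<mu> x * \<nu> (G x) y * (wa x f * wb y f) * (ka x f a * kb y f b) *
      (\<phi> a b / (a1 (G x) f a / a0 (G x) f))) \<le> 1"
proof -
  let ?T = "\<lambda>z x y f a b. \<mu> x * \<nu> z y * (wa x f * wb y f) * (ka x f a * kb y f b) *
      (\<phi> a b / (a1 z f a / a0 z f))"
  let ?Xz = "\<lambda>z. {x\<in>X. G x = z}"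
  have a0: "a0 z f \<ge> 0" for z f
    unfolding a0_def by (intro sum_nonneg mult_nonneg_nonneg nn)
  \<comment> \<open>With \<open>z\<close>, \<open>y\<close> and \<open>f\<close> fixed, summing over
    Alice's blocks in the class of \<open>z\<close> produces \<open>a1 z f a\<close>, which the tilt
    divides out again. Then Bob's key and the guess \<open>\<phi>\<close> sum to at most 1.\<close>
  have inner: "(\<Sum>x\<in>?Xz z. \<Sum>a\<in>K. \<Sum>b\<in>K. ?T z x y f a b) \<le> (\<Sum>x\<in>?Xz z. \<mu> x * \<nu> z y * (wa x f * wb y f))" for z y f
  proof -
    have "(\<Sum>x\<in>?Xz z. \<Sum>a\<in>K. \<Sum>b\<in>K. ?T z x y f a b) = (\<Sum>a\<in>K. \<Sum>x\<in>?Xz z. \<Sum>b\<in>K. ?T z x y f a b)"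
      by (rule sum.swap)
    also have "\<dots> = (\<Sum>a\<in>K. \<Sum>b\<in>K. \<Sum>x\<in>?Xz z. ?T z x y f a b)"
      by (intro sum.cong refl sum.swap)
    also have "\<dots> = (\<Sum>a\<in>K. \<Sum>b\<in>K. \<nu> z y * wb y f * (kb y f b * \<phi> a b) * (a1 z f a / (a1 z f a / a0 z f)))"
      unfolding a1_def sum_divide_distrib sum_distrib_left
      by (intro sum.cong refl) (simp add: field_simps)
    \<comment> \<open>The quotient equals \<open>a0 z f\<close> unless \<open>a1 z f a\<close>
      vanishes, when it is 0; hence an inequality.\<close>
    also have "\<dots> \<le> (\<Sum>a\<in>K. \<Sum>b\<in>K. \<nu> z y * wb y f * (kb y f b * \<phi> a b) * a0 z f)"
      using a0[of z f] by (intro sum_mono mult_left_mono mult_nonneg_nonneg nn) auto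
    also have "\<dots> = \<nu> z y * wb y f * a0 z f * (\<Sum>b\<in>K. kb y f b * (\<Sum>a\<in>K. \<phi> a b))"
      by (subst sum.swap) (simp add: sum_distrib_left mult_ac)
    also have "\<dots> \<le> \<nu> z y * wb y f * a0 z f * 1"
    proof (intro mult_left_mono mult_nonneg_nonneg nn a0)
      have "(\<Sum>b\<in>K. kb y f b * (\<Sum>a\<in>K. \<phi> a b)) \<le> (\<Sum>b\<in>K. kb y f b * 1)"
        by (intro sum_mono mult_left_mono \<phi> nn)
      also have "\<dots> \<le> 1" using kb by simp
      finally show "(\<Sum>b\<in>K. kb y f b * (\<Sum>a\<in>K. \<phi> a b)) \<le> 1" .
    qed
    also have "\<dots> = (\<Sum>x\<in>?Xz z. \<mu> x * \<nu> z y * (wa x f * wb y f))"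
      unfolding a0_def by (simp add: sum_distrib_left mult_ac)
    finally show ?thesis .
  qed
  \<comment> \<open>Grouping the blocks \<open>x\<close> by Eve's value \<open>z\<close> makes
    \<open>\<nu> z y\<close> constant within a group, so the sums over \<open>y\<close> and
    \<open>f\<close> can be pulled outside, as \<open>inner\<close> requires. The regrouping is
    undone once the keys are gone.\<close>
  have "(\<Sum>x\<in>X. \<Sum>y\<in>Y. \<Sum>f\<in>F. \<Sum>a\<in>K. \<Sum>b\<in>K. ?T (G x) x y f a b)
     = (\<Sum>z\<in>G ` X. \<Sum>x\<in>?Xz z. \<Sum>y\<in>Y. \<Sum>f\<in>F. \<Sum>a\<in>K. \<Sum>b\<in>K. ?T (G x) x y f a b)"
    by (rule sum.image_gen[OF fin(1)])
  also have "\<dots> = (\<Sum>z\<in>G ` X. \<Sum>x\<in>?Xz z. \<Sum>y\<in>Y. \<Sum>f\<in>F. \<Sum>a\<in>K. \<Sum>b\<in>K. ?T z x y f a b)"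
    by (intro sum.cong) auto
  also have "\<dots> = (\<Sum>z\<in>G ` X. \<Sum>y\<in>Y. \<Sum>x\<in>?Xz z. \<Sum>f\<in>F. \<Sum>a\<in>K. \<Sum>b\<in>K. ?T z x y f a b)"
    by (intro sum.cong refl sum.swap)
  also have "\<dots> = (\<Sum>z\<in>G ` X. \<Sum>y\<in>Y. \<Sum>f\<in>F. \<Sum>x\<in>?Xz z. \<Sum>a\<in>K. \<Sum>b\<in>K. ?T z x y f a b)"
    by (intro sum.cong refl sum.swap)
  also have "\<dots> \<le> (\<Sum>z\<in>G ` X. \<Sum>y\<in>Y. \<Sum>f\<in>F. \<Sum>x\<in>?Xz z. \<mu> x * \<nu> z y * (wa x f * wb y f))"
    by (intro sum_mono inner)
  also have "\<dots> = (\<Sum>z\<in>G ` X. \<Sum>y\<in>Y. \<Sum>x\<in>?Xz z. \<Sum>f\<in>F. \<mu> x * \<nu> z y * (wa x f * wb y f))"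
    by (intro sum.cong refl sum.swap)
  also have "\<dots> = (\<Sum>z\<in>G ` X. \<Sum>x\<in>?Xz z. \<Sum>y\<in>Y. \<Sum>f\<in>F. \<mu> x * \<nu> z y * (wa x f * wb y f))"
    by (intro sum.cong refl sum.swap)
  also have "\<dots> = (\<Sum>z\<in>G ` X. \<Sum>x\<in>?Xz z. \<Sum>y\<in>Y. \<mu> x * (\<nu> (G x) y * (\<Sum>f\<in>F. wa x f * wb y f)))"
    by (intro sum.cong) (auto simp: sum_distrib_left mult_ac)
  also have "\<dots> = (\<Sum>x\<in>X. \<Sum>y\<in>Y. \<mu> x * (\<nu> (G x) y * (\<Sum>f\<in>F. wa x f * wb y f)))"
    by (rule sum.image_gen[OF fin(1), symmetric])
  also have "\<dots> \<le> (\<Sum>x\<in>X. \<Sum>y\<in>Y. \<mu> x * (\<nu> (G x) y * 1))"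
    by (intro sum_mono mult_left_mono w nn)
  also have "\<dots> = (\<Sum>x\<in>X. \<mu> x * sum (\<nu> (G x)) Y)"
    by (simp add: sum_distrib_left)
  also have "\<dots> \<le> (\<Sum>x\<in>X. \<mu> x * 1)"
    by (intro sum_mono mult_left_mono \<nu> nn)
  also have "\<dots> \<le> 1" using \<mu> by simp
  finally show ?thesis .
qed

section \<open>The likelihood ratio between the true and the resampled letters\<close>

lemma log_prod:
  "finite I \<Longrightarrow> (\<And>i. i \<in> I \<Longrightarrow> f i > 0) \<Longrightarrow> log b (prod f I) = (\<Sum>i\<in>I. log b (f i))"
  unfolding log_def sum_divide_distrib[symmetric] by (subst ln_prod) force+

text \<open>The density of I(X;Y|Z) at one letter, which \<open>log_resampled_ratio\<close> confirms
  with the opposite sign. An erasure tells nothing; a received letter tells all that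
  \<open>z\<close> leaves open.\<close>

definition unerased_info :: "real \<Rightarrow> 'x pmf \<Rightarrow> ('x \<Rightarrow> 'z) \<Rightarrow> 'x \<Rightarrow> 'x option \<Rightarrow> real" where
  "unerased_info b p g x y = (case y of None \<Rightarrow> 0 | Some x' \<Rightarrow> - log b (posterior p g x))"

text \<open>The law of Bob's letter given only Eve's letter \<open>z\<close>.\<close>

definition resampled_prob :: "'x pmf \<Rightarrow> ('x \<Rightarrow> 'z) \<Rightarrow> real \<Rightarrow> 'z \<Rightarrow> 'x option \<Rightarrow> real" where
  "resampled_prob p g \<epsilon> z y =
     (case y of None \<Rightarrow> \<epsilon> | Some x \<Rightarrow> (1 - \<epsilon>) * (if g x = z then posterior p g x else 0))"

lemma erasure_prob_nonneg: "0 \<le> \<epsilon> \<Longrightarrow> \<epsilon> \<le> 1 \<Longrightarrow> erasure_prob \<epsilon> x y \<ge> 0"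
  by (simp add: erasure_prob_def split: option.split)

lemma resampled_prob_nonneg: "0 \<le> \<epsilon> \<Longrightarrow> \<epsilon> \<le> 1 \<Longrightarrow> resampled_prob p g \<epsilon> z y \<ge> 0"
  by (simp add: resampled_prob_def posterior_nonneg split: option.split)

lemma sum_resampled_prob_le:
  fixes p :: "'x::finite pmf"
  assumes \<epsilon>: "0 \<le> \<epsilon>" "\<epsilon> \<le> 1"
  shows "(\<Sum>y\<in>UNIV. resampled_prob p g \<epsilon> z y) \<le> 1"
proof -
  have "(\<Sum>y\<in>UNIV. resampled_prob p g \<epsilon> z y) = \<epsilon> + (\<Sum>x\<in>UNIV. resampled_prob p g \<epsilon> z (Some x))"
    unfolding UNIV_option_conv
    by (subst sum.insert) (auto simp: sum.reindex resampled_prob_def)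
  also have "(\<Sum>x\<in>UNIV. resampled_prob p g \<epsilon> z (Some x)) = (1 - \<epsilon>) * (\<Sum>x | g x = z. posterior p g x)"
    by (simp add: resampled_prob_def sum_distrib_left sum.If_cases if_distrib cong: if_cong)
  also have "\<epsilon> + \<dots> \<le> \<epsilon> + (1 - \<epsilon>) * 1"
    using \<epsilon> by (intro add_left_mono mult_left_mono sum_posterior_le) auto
  finally show ?thesis by simp
qed

text \<open>Absolute continuity of the true law with respect to the reference law, which the
  logarithm of the likelihood ratio requires.\<close>

lemma resampled_prob_pos:
  assumes "x \<in> set_pmf p" "erasure_prob \<epsilon> x y > 0"
  shows "resampled_prob p g \<epsilon> (g x) y > 0"
  using assms posterior_pos[of x p g]
  by (auto simp: erasure_prob_def resampled_prob_def zero_less_mult_iff of_bool_def split: option.splits if_splits)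

lemma log_resampled_ratio:
  assumes "x \<in> set_pmf p" "erasure_prob \<epsilon> x y > 0"
  shows "log b (resampled_prob p g \<epsilon> (g x) y / erasure_prob \<epsilon> x y) = - unerased_info b p g x y"
  using assms
  by (auto simp: erasure_prob_def resampled_prob_def unerased_info_def of_bool_def split: option.splits if_splits)

lemma expect_unerased_info:
  fixes p :: "'x::finite pmf" and g :: "'x \<Rightarrow> 'z::finite"
  assumes \<epsilon>: "0 \<le> \<epsilon>" "\<epsilon> \<le> 1"
  shows "expect (erasure_block n p g \<epsilon>) (\<lambda>(x, y). \<Sum>i<n. unerased_info b p g (x ! i) (y ! i))
     = n * ((1 - \<epsilon>) * post_ent b p g)"
  unfolding expect_erasure_block_sum[OF \<epsilon>] by (simp add: unerased_info_def post_ent_def)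

lemma erasure_block_pos:
  fixes p :: "'x::finite pmf"
  assumes \<epsilon>: "0 \<le> \<epsilon>" "\<epsilon> \<le> 1" and xy: "(x, y) \<in> set_pmf (erasure_block n p g \<epsilon>)" and i: "i < n"
  shows "x ! i \<in> set_pmf p" "erasure_prob \<epsilon> (x ! i) (y ! i) > 0"
proof -
  have "pmf (erasure_block n p g \<epsilon>) (x, y) > 0"
    using xy by (simp add: pmf_positive)
  hence "(\<Prod>i<n. pmf p (x ! i) * erasure_prob \<epsilon> (x ! i) (y ! i)) > 0"
    using length_erasure_block[OF xy] by (simp add: pmf_erasure_block[OF \<epsilon>])
  hence "(\<Prod>i<n. pmf p (x ! i) * erasure_prob \<epsilon> (x ! i) (y ! i)) \<noteq> 0"
    by (metis less_irrefl)
  hence "pmf p (x ! i) * erasure_prob \<epsilon> (x ! i) (y ! i) \<noteq> 0"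
    using i by simp
  thus "x ! i \<in> set_pmf p" "erasure_prob \<epsilon> (x ! i) (y ! i) > 0"
    using erasure_prob_nonneg[OF \<epsilon>, of "x ! i" "y ! i"] by (auto simp: set_pmf_iff)
qed

lemma alice_weight_nonneg: "alice_weight \<pi> x f \<ge> 0"
  unfolding alice_weight_def by (intro prod_nonneg) auto

lemma bob_weight_nonneg: "bob_weight \<pi> x f \<ge> 0"
  unfolding bob_weight_def by (intro prod_nonneg) auto

text \<open>Fano's inequality, with the weight \<open>1 - t\<close> put on Bob's key as a guess of Alice's key and
  the weight \<open>t\<close> spread over the key alphabet.\<close>

lemma protocol_leftover_entropy_le:
  fixes p :: "'x::finite pmf" and g :: "'x \<Rightarrow> 'z::finite" and n :: nat
  assumes \<epsilon>: "0 \<le> \<epsilon>" "\<epsilon> \<le> 1" and b: "1 < b" and \<pi>: "valid_protocol \<pi>" and t: "0 < t" "t < 1"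
  defines "Q \<equiv> protocol_law (erasure_source p g \<epsilon>) n \<pi>"
  shows "ent b Q key_A - mut_inf b Q key_A eve_view \<le> n * ((1 - \<epsilon>) * post_ent b p g) - log b (1 - t)
    + measure_pmf.prob Q {\<omega>. key_A \<omega> \<noteq> key_B \<omega>} * (log b (card (key_alphabet \<pi>)) - log b t)"
proof -
  define D where "D = erasure_block n p g \<epsilon>"
  define L where "L = run_law D \<pi>"
  define \<Phi> :: "('x list \<times> 'x option list) \<times> nat list \<times> nat \<times> nat \<Rightarrow> _" where
    "\<Phi> = (\<lambda>((x, y), f, a, b). ((x, y, map g x), f, a, b))"
  have Q: "Q = map_pmf \<Phi> L"
    by (simp add: Q_def L_def D_def \<Phi>_def protocol_law_eq_map)
  have finD: "finite (set_pmf D)" unfolding D_def by (rule finite_erasure_block)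
  have finL: "finite (set_pmf L)" unfolding L_def by (rule finite_run_law[OF \<pi> finD])
  define K where "K = key_alphabet \<pi>"
  define F where "F = {f. set f \<subseteq> msg_alphabet \<pi> \<and> length f = rounds \<pi>}"
  define X where "X = {x :: 'x list. length x = n}"
  define Y where "Y = {y :: 'x option list. length y = n}"
  have fin: "finite X" "finite Y" "finite F" "finite K"
    using \<pi> by (auto simp: X_def Y_def F_def K_def valid_protocol_def finite_lists_length finite_lists_length_eq)
  define kA where "kA = (\<lambda>(s :: 'x list \<times> 'x option list, f :: nat list, a :: nat, b :: nat). a)"
  define kB where "kB = (\<lambda>(s :: 'x list \<times> 'x option list, f :: nat list, a :: nat, b :: nat). b)"
  define v where "v = (\<lambda>((x, y :: 'x option list), f :: nat list, a :: nat, b :: nat). (map g x, f))"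
  have KA: "(\<lambda>w. key_A (\<Phi> w)) = kA" and KB: "(\<lambda>w. key_B (\<Phi> w)) = kB" and V: "(\<lambda>w. eve_view (\<Phi> w)) = v"
    by (auto simp: fun_eq_iff \<Phi>_def key_A_def key_B_def eve_view_def kA_def kB_def v_def)
  have cell: "x \<in> X" "y \<in> Y" "f \<in> F" "a \<in> K" "k \<in> K" "(x, y) \<in> set_pmf D"
    if "((x, y), f, a, k) \<in> set_pmf L" for x y f a k
    using set_run_law[OF \<pi> that[unfolded L_def]] length_erasure_block[of x y n p g \<epsilon>]
    by (auto simp: X_def Y_def F_def K_def D_def)
  obtain k0 where "k0 \<in> K"
    using cell(4) set_pmf_not_empty[of L] by fast
  hence cardK: "card K \<ge> 1" using fin by (metis card_0_eq empty_iff less_one not_less)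

  define \<mu> where "\<mu> = (\<lambda>x. pmf (replicate_pmf n p) x)"
  define \<nu> where "\<nu> = (\<lambda>z y. \<Prod>i<n. resampled_prob p g \<epsilon> (z ! i) (y ! i))"
  define wa where "wa = alice_weight \<pi>"
  define wb where "wb = bob_weight \<pi>"
  define ka where "ka = (\<lambda>x f a. pmf (alice_key \<pi> x f) a)"
  define kb where "kb = (\<lambda>y f a. pmf (bob_key \<pi> y f) a)"
  define \<phi> where "\<phi> = (\<lambda>a k :: nat. if a = k then 1 - t else t / card K)"
  \<comment> \<open>Alice's share of the reference weight of Eve's view, without and with the key
    \<open>a\<close>. Bob's share is the same in both, so the quotient \<open>\<alpha>\<close> is
    the reference law of Alice's key given the view.\<close>
  define a0 where "a0 = (\<lambda>z f. \<Sum>x\<in>{x\<in>X. map g x = z}. \<mu> x * wa x f)"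
  define a1 where "a1 = (\<lambda>z f a. \<Sum>x\<in>{x\<in>X. map g x = z}. \<mu> x * wa x f * ka x f a)"
  define U where "U = (\<lambda>((x, y), f :: nat list, a, k).
    (\<Sum>i<n. unerased_info b p g (x ! i) (y ! i)) + (- log b (\<phi> a k)))"
  define \<alpha> where "\<alpha> = (\<lambda>a (z, f). a1 z f a / a0 z f)"
  have nn: "\<mu> x \<ge> 0" "\<nu> z y \<ge> 0" "wa x f \<ge> 0" "wb y f \<ge> 0" "ka x f a \<ge> 0" "kb y f k \<ge> 0" "\<phi> a k \<ge> 0" for x z y f a k
    using t by (auto simp: \<mu>_def \<nu>_def wa_def wb_def ka_def kb_def \<phi>_def alice_weight_nonneg bob_weight_nonneg
        intro!: prod_nonneg resampled_prob_nonneg[OF \<epsilon>])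
  have \<phi>_pos: "\<phi> a k > 0" for a k using t cardK by (auto simp: \<phi>_def)
  have ka_sum: "sum (ka x f) K \<le> 1" and kb_sum: "sum (kb y f) K \<le> 1" for x y f
    unfolding ka_def kb_def using fin by (metis measure_measure_pmf_finite measure_pmf.prob_le_1)+
  have \<mu>_sum: "sum \<mu> X \<le> 1"
    unfolding \<mu>_def using fin by (metis measure_measure_pmf_finite measure_pmf.prob_le_1)
  have \<nu>_sum: "sum (\<nu> z) Y \<le> 1" for z
    unfolding \<nu>_def Y_def
    by (rule sum_lists_prod_le) (auto intro: resampled_prob_nonneg sum_resampled_prob_le \<epsilon>)
  have trans: "pmf (transcript \<pi> x y (rounds \<pi>)) f = wa x f * wb y f" if "f \<in> F" for x y f
    using that pmf_transcript[of f "rounds \<pi>" \<pi> x y] by (simp add: F_def wa_def wb_def)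
  have w_sum: "(\<Sum>f\<in>F. wa x f * wb y f) \<le> 1" for x y
  proof -
    have "(\<Sum>f\<in>F. wa x f * wb y f) = sum (pmf (transcript \<pi> x y (rounds \<pi>))) F"
      by (intro sum.cong) (auto simp: trans)
    also have "\<dots> \<le> 1" using fin by (metis measure_measure_pmf_finite measure_pmf.prob_le_1)
    finally show ?thesis .
  qed
  have \<phi>_sum: "(\<Sum>a\<in>K. \<phi> a k) \<le> 1" if "k \<in> K" for k
  proof -
    have "(\<Sum>a\<in>K. \<phi> a k) = (1 - t) + (\<Sum>a\<in>K - {k}. t / card K)"
      using fin that by (subst sum.remove[of _ k]) (auto simp: \<phi>_def intro!: sum.cong)
    also have "\<dots> \<le> (1 - t) + (\<Sum>a\<in>K. t / card K)"
      using fin t by (intro add_left_mono sum_mono2) auto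
    also have "\<dots> = 1" using cardK by simp
    finally show ?thesis .
  qed
  have a_nn: "a0 z f \<ge> 0" "a1 z f a \<ge> 0" for z f a
    unfolding a0_def a1_def by (intro sum_nonneg mult_nonneg_nonneg nn)+
  have pmfL: "pmf L ((x, y), f, a, k) = pmf D (x, y) * ((wa x f * wb y f) * (ka x f a * kb y f k))"
    if "f \<in> F" for x y f a k
    by (simp add: L_def pmf_run_law trans[OF that] ka_def kb_def)
  have pmfD: "pmf D (x, y) = \<mu> x * (\<Prod>i<n. erasure_prob \<epsilon> (x ! i) (y ! i))" if "x \<in> X" "y \<in> Y" for x y
    using that by (simp add: D_def X_def Y_def pmf_erasure_block[OF \<epsilon>] \<mu>_def pmf_replicate_pmf prod.distrib)
  have pos: "\<mu> x > 0" "wa x f > 0" "wb y f > 0" "ka x f a > 0" "kb y f k > 0" "a1 (map g x) f a > 0" "a0 (map g x) f > 0"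
    if "((x, y), f, a, k) \<in> set_pmf L" for x y f a k
  proof -
    note c = cell[OF that]
    have "pmf L ((x, y), f, a, k) \<noteq> 0" using that by (simp add: set_pmf_iff)
    hence "\<mu> x \<noteq> 0" "wa x f \<noteq> 0" "wb y f \<noteq> 0" "ka x f a \<noteq> 0" "kb y f k \<noteq> 0"
      using pmfL[OF c(3)] pmfD[OF c(1,2)] by auto
    with nn show p: "\<mu> x > 0" "wa x f > 0" "wb y f > 0" "ka x f a > 0" "kb y f k > 0"
      by (simp_all add: less_le)
    show "a1 (map g x) f a > 0" unfolding a1_def
      by (rule sum_pos2[of _ x]) (use fin c p nn in \<open>auto intro!: mult_nonneg_nonneg\<close>)
    show "a0 (map g x) f > 0" unfolding a0_def
      by (rule sum_pos2[of _ x]) (use fin c p nn in \<open>auto intro!: mult_nonneg_nonneg\<close>)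
  qed

  have "ent b Q key_A - mut_inf b Q key_A eve_view = cond_ent b Q key_A eve_view"
    using b finL by (intro ent_minus_mut_inf) (auto simp: Q)
  also have "\<dots> = cond_ent b L kA v"
    unfolding Q cond_ent_map_pmf[OF b finL] KA V ..
  \<comment> \<open>\<open>\<alpha>\<close> belongs to the reference law and not to
    \<open>L\<close>; the cross-entropy bound tolerates the mismatch.\<close>
  also have "\<dots> \<le> expect L (\<lambda>w. - log b (\<alpha> (kA w) (v w)))"
  proof (rule cond_ent_le_expect[OF b finL fin(4)])
    show "kA ` set_pmf L \<subseteq> K" using cell(4) by (auto simp: kA_def)
    show "\<alpha> (kA w) (v w) > 0" if "w \<in> set_pmf L" for w
      using that pos(6,7) by (auto simp: kA_def v_def \<alpha>_def split: prod.splits)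
    show "\<alpha> a c \<ge> 0" for a c using a_nn by (auto simp: \<alpha>_def split: prod.split)
    show "(\<Sum>a\<in>K. \<alpha> a c) \<le> 1" for c
    proof -
      obtain z f where c: "c = (z, f)" by fastforce
      have "(\<Sum>a\<in>K. \<alpha> a c) = (\<Sum>a\<in>K. a1 z f a) / a0 z f"
        by (simp add: \<alpha>_def c sum_divide_distrib)
      also have "(\<Sum>a\<in>K. a1 z f a) \<le> a0 z f"
      proof -
        have "(\<Sum>a\<in>K. a1 z f a) = (\<Sum>x\<in>{x\<in>X. map g x = z}. \<mu> x * wa x f * sum (ka x f) K)"
          unfolding a1_def by (subst sum.swap) (simp add: sum_distrib_left)
        also have "\<dots> \<le> (\<Sum>x\<in>{x\<in>X. map g x = z}. \<mu> x * wa x f * 1)"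
          by (intro sum_mono mult_left_mono ka_sum mult_nonneg_nonneg nn)
        finally show ?thesis by (simp add: a0_def)
      qed
      hence "(\<Sum>a\<in>K. a1 z f a) / a0 z f \<le> 1"
        using a_nn(1)[of z f] by (auto simp: divide_le_eq_1 intro: antisym)
      finally show ?thesis .
    qed
  qed
  also have "\<dots> \<le> expect L U"
  proof -
    \<comment> \<open>The reference law of the run, tilted by \<open>\<phi> a k\<close> over
      \<open>\<alpha>\<close>. Given the view, Alice's key has law \<open>\<alpha>\<close> there and
      is independent of Bob's, so the tilt trades her key for the guess \<open>\<phi>\<close> and
      keeps the mass at most 1. The logarithm of \<open>r\<close> over \<open>pmf L\<close> is then
      exactly the difference of the two integrands to be compared.\<close>
    define r where "r = (\<lambda>((x, y), f, a, k). \<mu> x * \<nu> (map g x) y * (wa x f * wb y f) * (ka x f a * kb y f k) *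
      (\<phi> a k / (a1 (map g x) f a / a0 (map g x) f)))"
    let ?S = "(X \<times> Y) \<times> F \<times> K \<times> K"
    have "expect L (\<lambda>w. log b (r (id w) / pmf (map_pmf id L) (id w))) \<le> 0"
    proof (rule expect_log_pmf_ratio_le[OF finL b])
      show "finite ?S" using fin by simp
      show "id ` set_pmf L \<subseteq> ?S" using cell by auto
      show "r w \<ge> 0" for w
        unfolding r_def by (auto split: prod.split intro!: mult_nonneg_nonneg divide_nonneg_nonneg nn a_nn)
      have "sum r ?S = (\<Sum>x\<in>X. \<Sum>y\<in>Y. \<Sum>f\<in>F. \<Sum>a\<in>K. \<Sum>k\<in>K. r ((x, y), f, a, k))"
        by (simp add: sum.cartesian_product[symmetric] sum.cartesian_product' prod.case_distrib)
      also have "\<dots> \<le> 1"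
        unfolding r_def prod.case a0_def a1_def
        by (rule sum_decoupled_guess_le[where G="map g", OF fin nn \<mu>_sum \<nu>_sum w_sum kb_sum \<phi>_sum])
      finally show "sum r ?S \<le> 1" .
      show "r (id w) > 0" if "w \<in> set_pmf L" for w
      proof -
        obtain x y f a k where w: "w = ((x, y), f, a, k)" by (cases w) auto
        have "\<nu> (map g x) y > 0"
          unfolding \<nu>_def
        proof (rule prod_pos)
          fix i assume i: "i \<in> {..<n}"
          note e = erasure_block_pos[OF \<epsilon>, of x y n p g i]
          have "(x, y) \<in> set_pmf (erasure_block n p g \<epsilon>)" "length x = n"
            using cell[OF that[unfolded w]] by (auto simp: D_def X_def)
          thus "resampled_prob p g \<epsilon> (map g x ! i) (y ! i) > 0"
            using i e by (simp add: resampled_prob_pos)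
        qed
        thus ?thesis using pos[OF that[unfolded w]] \<phi>_pos[of a k] by (simp add: w r_def)
      qed
    qed
    also have "expect L (\<lambda>w. log b (r (id w) / pmf (map_pmf id L) (id w))) = expect L (\<lambda>w. - log b (\<alpha> (kA w) (v w)) -
      U w)"
    proof (rule expect_cong_pmf)
      fix w assume "w \<in> set_pmf L"
      obtain x y f a k where w: "w = ((x, y), f, a, k)" by (cases w) auto
      have wL: "((x, y), f, a, k) \<in> set_pmf L" using \<open>w \<in> set_pmf L\<close> w by simp
      note c = cell[OF wL] and p = pos[OF wL]
      have len: "length x = n" using c(1) by (simp add: X_def)
      have e: "x ! i \<in> set_pmf p" "erasure_prob \<epsilon> (x ! i) (y ! i) > 0" if "i < n" for i
        using erasure_block_pos[OF \<epsilon> c(6)[unfolded D_def] that] by auto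
      \<comment> \<open>The law of Alice's block and all kernels of the protocol occur in both laws
        and cancel. What remains does not see the number of rounds.\<close>
      have rw: "r w / pmf L w = (\<Prod>i<n. resampled_prob p g \<epsilon> (g (x ! i)) (y ! i) / erasure_prob \<epsilon> (x ! i) (y ! i))
         * (\<phi> a k / (a1 (map g x) f a / a0 (map g x) f))"
        using p len unfolding w r_def prod.case pmfL[OF c(3)] pmfD[OF c(1,2)] \<nu>_def prod_dividef
        by (simp add: mult.assoc)
      have "log b (r w / pmf L w) = log b (\<Prod>i<n. resampled_prob p g \<epsilon> (g (x ! i)) (y ! i) / erasure_prob \<epsilon> (x ! i) (y ! i))
         + (log b (\<phi> a k) - log b (a1 (map g x) f a / a0 (map g x) f))"
      proof -
        have "(\<Prod>i<n. resampled_prob p g \<epsilon> (g (x ! i)) (y ! i) / erasure_prob \<epsilon> (x ! i) (y ! i)) > 0"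
          using e by (intro prod_pos) (simp add: resampled_prob_pos)
        moreover have "a1 (map g x) f a / a0 (map g x) f > 0" using p by simp
        ultimately show ?thesis
          using \<phi>_pos[of a k] by (simp only: rw log_mult_pos log_divide_pos divide_pos_pos)
      qed
      also have "log b (\<Prod>i<n. resampled_prob p g \<epsilon> (g (x ! i)) (y ! i) / erasure_prob \<epsilon> (x ! i) (y ! i))
         = (\<Sum>i<n. log b (resampled_prob p g \<epsilon> (g (x ! i)) (y ! i) / erasure_prob \<epsilon> (x ! i) (y ! i)))"
        using e by (intro log_prod) (auto simp: resampled_prob_pos)
      also have "\<dots> = - (\<Sum>i<n. unerased_info b p g (x ! i) (y ! i))"
        unfolding sum_negf[symmetric] by (intro sum.cong refl log_resampled_ratio e) auto
      finally show "log b (r (id w) / pmf (map_pmf id L) (id w)) = - log b (\<alpha> (kA w) (v w)) -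
      U w"
        by (simp add: pmf.map_id w kA_def v_def \<alpha>_def U_def)
    qed
    also have "\<dots> = expect L (\<lambda>w. - log b (\<alpha> (kA w) (v w))) - expect L U"
      by (rule Bochner_Integration.integral_diff) (auto intro: integrable_measure_pmf_finite finL)
    finally show ?thesis by simp
  qed
  also have "\<dots> \<le> expect L (\<lambda>w. (case fst w of (x, y) \<Rightarrow> \<Sum>i<n. unerased_info b p g (x ! i) (y ! i)) +
      (- log b (1 - t) + indicator {w. kA w \<noteq> kB w} w * (log b (card K) - log b t)))"
  proof (rule expect_mono_pmf[OF finL], clarsimp simp: U_def)
    fix a k :: nat and x y and f :: "nat list"
    \<comment> \<open>When the keys differ, the summand \<open>- log b (1 - t)\<close> is surplus,
      so its sign has to be known.\<close>
    have "log b (1 - t) \<le> 0" using t b by (subst log_le_zero_cancel_iff) auto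
    thus "- log b (\<phi> a k) \<le> indicator {w. kA w \<noteq> kB w} ((x, y), f, a, k) * (log b (card K) - log b t) - log b (1 - t)"
      using t cardK b by (auto simp: \<phi>_def kA_def kB_def log_divide_pos)
  qed
  also have "\<dots> = expect L (\<lambda>w. case fst w of (x, y) \<Rightarrow> \<Sum>i<n. unerased_info b p g (x ! i) (y ! i)) +
      (- log b (1 - t) + measure_pmf.prob L {w. kA w \<noteq> kB w} * (log b (card K) - log b t))"
  proof -
    have I: "integrable L h" for h :: "_ \<Rightarrow> real"
      using finL by (rule integrable_measure_pmf_finite)
    show ?thesis
      unfolding Bochner_Integration.integral_add[OF I I] by simp
  qed
  also have "expect L (\<lambda>w. case fst w of (x, y) \<Rightarrow> \<Sum>i<n. unerased_info b p g (x ! i) (y ! i))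
     = expect (map_pmf fst L) (\<lambda>(x, y). \<Sum>i<n. unerased_info b p g (x ! i) (y ! i))"
    by simp
  also have "\<dots> = n * ((1 - \<epsilon>) * post_ent b p g)"
    by (simp only: L_def map_fst_run_law D_def expect_unerased_info[OF \<epsilon>])
  also have "measure_pmf.prob L {w. kA w \<noteq> kB w} = measure_pmf.prob Q {\<omega>. key_A \<omega> \<noteq> key_B \<omega>}"
    by (simp add: Q vimage_def KA[THEN fun_cong] KB[THEN fun_cong])
  finally show ?thesis by (simp add: K_def)
qed

lemma card_key_alphabet_pos:
  assumes "valid_protocol \<pi>"
  shows "card (key_alphabet \<pi>) \<ge> 1"
proof -
  have "set_pmf (alice_key \<pi> [] []) \<subseteq> key_alphabet \<pi>" "finite (key_alphabet \<pi>)"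
    using assms by (auto simp: valid_protocol_def)
  hence "card (key_alphabet \<pi>) \<noteq> 0"
    using set_pmf_not_empty[of "alice_key \<pi> [] []"] by auto
  thus ?thesis by simp
qed

text \<open>The Fano bound is taken at \<open>t = \<delta>\<close>. Near-uniformity of the key
  bounds \<open>log b (card (key_alphabet \<pi>))\<close> by \<open>n * (R + \<delta>)\<close>, so
  the Fano term is linear in \<open>n\<close>. The constant terms are nonnegative, and
  \<open>n >= 1\<close> lets them be multiplied by \<open>n\<close> before dividing it out.\<close>

lemma code_rate_le:
  fixes p :: "'x::finite pmf" and g :: "'x \<Rightarrow> 'z::finite"
  assumes \<epsilon>: "0 \<le> \<epsilon>" "\<epsilon> \<le> 1" and b: "1 < b" and \<delta>: "0 < \<delta>" "\<delta> < 1"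
    and code: "is_code b (erasure_source p g \<epsilon>) n R \<delta> \<pi>"
  shows "R * (1 - \<delta>) \<le> (1 - \<epsilon>) * post_ent b p g + \<delta> + \<delta>\<^sup>2 - log b (1 - \<delta>) - \<delta> * log b \<delta>"
proof -
  let ?Q = "protocol_law (erasure_source p g \<epsilon>) n \<pi>"
  let ?C = "(1 - \<epsilon>) * post_ent b p g" and ?k = "log b (card (key_alphabet \<pi>))"
  have n: "real n \<ge> 1" and \<pi>: "valid_protocol \<pi>"
    and R: "ent b ?Q key_A = n * R"
    and agree: "measure_pmf.prob ?Q {\<omega>. key_A \<omega> = key_B \<omega>} \<ge> 1 - \<delta>"
    and kn: "R \<ge> ?k / n - \<delta>" and leak: "mut_inf b ?Q key_A eve_view \<le> n * \<delta>"
    using code by (auto simp: is_code_def divide_le_eq mult.commute)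
  have k: "?k \<le> n * (R + \<delta>)"
  proof -
    have "?k / n \<le> R + \<delta>" using kn by linarith
    thus ?thesis using n by (simp add: divide_le_eq mult.commute)
  qed
  have k0: "?k \<ge> 0"
    using card_key_alphabet_pos[OF \<pi>] b by simp
  have l: "- log b \<delta> \<ge> 0" "- log b (1 - \<delta>) \<ge> 0"
    using \<delta> b by simp_all
  have "measure_pmf.prob ?Q {\<omega>. key_A \<omega> \<noteq> key_B \<omega>} = 1 - measure_pmf.prob ?Q {\<omega>. key_A \<omega> = key_B \<omega>}"
    using measure_pmf.prob_compl[of "{\<omega>. key_A \<omega> = key_B \<omega>}" ?Q]
    by (simp add: Compl_eq_Diff_UNIV[symmetric] Collect_neg_eq)
  hence "measure_pmf.prob ?Q {\<omega>. key_A \<omega> \<noteq> key_B \<omega>} \<le> \<delta>"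
    using agree by simp
  hence "measure_pmf.prob ?Q {\<omega>. key_A \<omega> \<noteq> key_B \<omega>} * (?k - log b \<delta>) \<le> \<delta> * (n * (R + \<delta>) - log b \<delta>)"
    using k k0 l \<delta> by (intro mult_mono) auto
  hence "n * R - n * \<delta> \<le> n * ?C - log b (1 - \<delta>) + \<delta> * (n * (R + \<delta>) - log b \<delta>)"
    using protocol_leftover_entropy_le[OF \<epsilon> b \<pi> \<delta>, where n=n and p=p and g=g] R leak by linarith
  hence "n * (R * (1 - \<delta>) - ?C - \<delta> - \<delta>\<^sup>2) \<le> (- log b (1 - \<delta>)) + \<delta> * (- log b \<delta>)"
    by (simp add: algebra_simps power2_eq_square)
  also have "\<dots> \<le> n * ((- log b (1 - \<delta>)) + \<delta> * (- log b \<delta>))"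
  proof -
    have "0 \<le> (- log b (1 - \<delta>)) + \<delta> * (- log b \<delta>)"
      using l \<delta> by (intro add_nonneg_nonneg mult_nonneg_nonneg) auto
    from mult_right_mono[OF n this] show ?thesis by simp
  qed
  finally show ?thesis using n by (simp add: mult_le_cancel_left)
qed

text \<open>The bound of \<open>code_rate_le\<close> is free of the blocklength, so
  \<open>\<delta>\<close> can tend to 0 although \<open>n\<close> depends on
  \<open>\<delta>\<close>.\<close>

lemma achievable_le:
  fixes p :: "'x::finite pmf" and g :: "'x \<Rightarrow> 'z::finite"
  assumes \<epsilon>: "0 \<le> \<epsilon>" "\<epsilon> \<le> 1" and b: "1 < b"
    and R: "achievable b UNIV (erasure_source p g \<epsilon>) R"
  shows "R \<le> (1 - \<epsilon>) * post_ent b p g"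
proof -
  let ?C = "(1 - \<epsilon>) * post_ent b p g"
  let ?rhs = "\<lambda>\<delta>. ?C + \<delta> + \<delta>\<^sup>2 - ln (1 - \<delta>) / ln b - \<delta> * (ln \<delta> / ln b)"
  have "R * (1 - \<delta>) \<le> ?rhs \<delta>" if "0 < \<delta>" "\<delta> < 1" for \<delta>
    using R that code_rate_le[OF \<epsilon> b that, of p g] by (auto simp: achievable_def log_def)
  hence ev: "eventually (\<lambda>\<delta>. R * (1 - \<delta>) \<le> ?rhs \<delta>) (at_right 0)"
    by (auto simp: eventually_at_right_field intro!: exI[of _ 1])
  have lim: "((\<lambda>\<delta>. R * (1 - \<delta>)) \<longlongrightarrow> R * (1 - 0)) (at_right 0)"
    by (intro tendsto_intros)
  have "((\<lambda>\<delta>::real. \<delta> * ln \<delta>) \<longlongrightarrow> 0) (at_right 0)"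
    by real_asymp
  hence "((\<lambda>\<delta>::real. \<delta> * ln \<delta> / ln b) \<longlongrightarrow> 0 / ln b) (at_right 0)"
    using b by (intro tendsto_intros) auto
  hence "(?rhs \<longlongrightarrow> ?C + 0 + 0\<^sup>2 - ln (1 - 0) / ln b - 0 / ln b) (at_right 0)"
    using b by (intro tendsto_intros) auto
  from tendsto_le[OF _ this lim ev] show ?thesis by simp
qed

subsection \<open>Typicality\<close>

text \<open>Additivity of the variance: in the induction step the cross term contains the mean of
  the remaining sum, which is 0.\<close>

lemma expect_replicate_pmf_square:
  assumes fin: "finite (set_pmf p)" and 0: "expect p f = 0"
  shows "expect (replicate_pmf n p) (\<lambda>w. (\<Sum>x\<leftarrow>w. f x)\<^sup>2) = n * expect p (\<lambda>x. (f x)\<^sup>2)"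
proof (induction n)
  case (Suc n)
  have I: "integrable p h" "integrable (replicate_pmf n p) h'" for h h' :: "_ \<Rightarrow> real"
    using fin by (auto intro!: integrable_measure_pmf_finite finite_set_replicate_pmf)
  have "expect (replicate_pmf n p) (\<lambda>w. (\<Sum>v\<leftarrow>x # w. f v)\<^sup>2)
     = (f x)\<^sup>2 + 2 * f x * expect (replicate_pmf n p) (\<lambda>w. \<Sum>v\<leftarrow>w. f v) +
       expect (replicate_pmf n p) (\<lambda>w. (\<Sum>v\<leftarrow>w. f v)\<^sup>2)" for x
    by (simp add: power2_sum I)
  also have "\<dots> x = (f x)\<^sup>2 + n * expect p (\<lambda>x. (f x)\<^sup>2)" for x
    by (simp add: Suc.IH expect_replicate_pmf_sum[OF fin] 0)
  finally show ?case
    unfolding expect_replicate_pmf_Suc[OF fin] by (simp add: I algebra_simps)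
qed simp

text \<open>Chebyshev's inequality. The upper tail is the one that counts, because a block leaves a
  likely set only by being too surprising.\<close>

lemma prob_replicate_pmf_sum_gt:
  fixes \<eta> :: real
  assumes fin: "finite (set_pmf p)" and n: "n > 0" and \<eta>: "\<eta> > 0"
  shows "measure_pmf.prob (replicate_pmf n p) {w. (\<Sum>x\<leftarrow>w. f x) > n * (expect p f + \<eta>)}
    \<le> expect p (\<lambda>x. (f x - expect p f)\<^sup>2) / (n * \<eta>\<^sup>2)"
proof -
  let ?m = "expect p f" and ?W = "replicate_pmf n p"
  let ?A = "{w. (\<Sum>x\<leftarrow>w. f x) > n * (?m + \<eta>)}" and ?s = "\<lambda>w. \<Sum>x\<leftarrow>w. f x - ?m"
  have finW: "finite (set_pmf ?W)" by (rule finite_set_replicate_pmf[OF fin])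
  have "measure_pmf.prob ?W ?A = expect ?W (indicator ?A)" by simp
  also have "\<dots> \<le> expect ?W (\<lambda>w. (?s w)\<^sup>2 / (n * \<eta>)\<^sup>2)"
  proof (rule expect_mono_pmf[OF finW])
    fix w assume "w \<in> set_pmf ?W"
    hence s: "?s w = (\<Sum>x\<leftarrow>w. f x) - n * ?m"
      by (simp add: sum_list_subtractf sum_list_triv length_replicate_pmf)
    show "indicator ?A w \<le> (?s w)\<^sup>2 / (n * \<eta>)\<^sup>2"
    proof (cases "w \<in> ?A")
      case True
      hence "n * \<eta> \<le> ?s w" unfolding s by (simp add: algebra_simps)
      hence "(n * \<eta>)\<^sup>2 \<le> (?s w)\<^sup>2"
        using \<eta> by (intro power_mono) auto
      thus ?thesis using True n \<eta> by simp
    qed simp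
  qed
  also have "\<dots> = expect ?W (\<lambda>w. (?s w)\<^sup>2) / (n * \<eta>)\<^sup>2"
    by simp
  also have "expect ?W (\<lambda>w. (?s w)\<^sup>2) = n * expect p (\<lambda>x. (f x - ?m)\<^sup>2)"
    using fin by (intro expect_replicate_pmf_square) (auto simp: integrable_measure_pmf_finite)
  also have "\<dots> / (n * \<eta>)\<^sup>2 = expect p (\<lambda>x. (f x - ?m)\<^sup>2) / (n * \<eta>\<^sup>2)"
    using n by (simp add: power2_eq_square)
  finally show ?thesis .
qed

text \<open>The posterior weight of \<open>x\<close> given \<open>z\<close> and side information
  \<open>y\<close>, where \<open>None\<close> stands for no side information. One definition thus
  serves Bob, with his own letters, and the decoder that sees only \<open>z\<close> and bin indices,
  with \<open>None\<close> throughout.\<close>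

definition letter_weight :: "'x pmf \<Rightarrow> ('x \<Rightarrow> 'z) \<Rightarrow> 'x option \<Rightarrow> 'z \<Rightarrow> 'x \<Rightarrow> real" where
  "letter_weight p g y z x =
     (if g x = z then (case y of None \<Rightarrow> posterior p g x | Some x' \<Rightarrow> of_bool (x' = x)) else 0)"

definition likely_set ::
  "'x pmf \<Rightarrow> ('x \<Rightarrow> 'z) \<Rightarrow> nat \<Rightarrow> real \<Rightarrow> 'x option list \<Rightarrow> 'z list \<Rightarrow> 'x list set" where
  "likely_set p g n t y z =
     {x. length x = n \<and> t \<le> (\<Prod>i<n. letter_weight p g (y ! i) (z ! i) (x ! i))}"

lemma letter_weight_nonneg: "letter_weight p g y z x \<ge> 0"
  by (simp add: letter_weight_def posterior_nonneg split: option.split)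

lemma sum_letter_weight_le:
  fixes p :: "'x::finite pmf"
  shows "(\<Sum>x\<in>UNIV. letter_weight p g y z x) \<le> 1"
proof (cases y)
  case None
  then show ?thesis
    using sum_posterior_le[of p g z] by (simp add: letter_weight_def sum.If_cases)
next
  case (Some x')
  have "(\<Sum>x\<in>UNIV. letter_weight p g y z x) \<le> (\<Sum>x\<in>UNIV. if x = x' then 1 else 0)"
    by (intro sum_mono) (auto simp: letter_weight_def Some)
  then show ?thesis by simp
qed

text \<open>Every member weighs at least \<open>1 / T\<close>, and all weights together at most
  1.\<close>

lemma card_likely_set_le:
  fixes p :: "'x::finite pmf" and T :: real
  assumes "T > 0"
  shows "card (likely_set p g n (1 / T) y z) \<le> T"
proof -
  let ?S = "likely_set p g n (1 / T) y z"
  let ?w = "\<lambda>x. \<Prod>i<n. letter_weight p g (y ! i) (z ! i) (x ! i)"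
  have "card ?S * (1 / T) = (\<Sum>x\<in>?S. 1 / T)"
    by simp
  also have "\<dots> \<le> (\<Sum>x\<in>?S. ?w x)"
    by (intro sum_mono) (auto simp: likely_set_def)
  also have "\<dots> \<le> (\<Sum>x | length x = n. ?w x)"
    by (intro sum_mono2 prod_nonneg letter_weight_nonneg ballI finite_lists_length) (auto simp: likely_set_def)
  also have "\<dots> \<le> 1"
    by (rule sum_lists_prod_le) (auto intro: letter_weight_nonneg sum_letter_weight_le)
  finally show ?thesis using assms by (simp add: divide_le_eq)
qed

text \<open>\<open>y'\<close> either keeps Bob's letter or discards it. On the support the product
  weight is positive and its negative logarithm is a sum of i.i.d. copies of \<open>info\<close>, so
  missing the likely set forces this sum above \<open>n\<close> times its mean plus
  \<open>\<eta>\<close>, and Chebyshev's inequality applies.\<close>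

lemma prob_not_likely_le:
  fixes p :: "'x::finite pmf" and g :: "'x \<Rightarrow> 'z::finite" and n :: nat and \<epsilon> \<eta> :: real
  assumes b: "1 < b" and n: "n > 0" and \<eta>: "\<eta> > 0"
    and y': "\<And>x y. y' x y = y \<or> y' x y = None"
  defines "info \<equiv> \<lambda>(x, y, z :: 'z). case y' x y of None \<Rightarrow> - log b (posterior p g x) | Some _ \<Rightarrow> 0"
  defines "P \<equiv> erasure_source p g \<epsilon>"
  shows "measure_pmf.prob (erasure_block n p g \<epsilon>)
      {(x, y). x \<notin> likely_set p g n (1 / b powr (n * (expect P info + \<eta>))) (map2 y' x y) (map g x)}
    \<le> expect P (\<lambda>w. (info w - expect P info)\<^sup>2) / (n * \<eta>\<^sup>2)"
proof -
  let ?T = "b powr (n * (expect P info + \<eta>))"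
  have *: "(\<Sum>v\<leftarrow>w. info v) > n * (expect P info + \<eta>)"
    if w: "w \<in> set_pmf (replicate_pmf n P)"
      and notin: "map rv_X w \<notin> likely_set p g n (1 / ?T) (map2 y' (map rv_X w) (map rv_Y w)) (map g (map rv_X w))" for w
  proof (rule ccontr)
    assume "\<not> ?thesis"
    hence le: "(\<Sum>i<n. info (w ! i)) \<le> n * (expect P info + \<eta>)"
      using length_replicate_pmf[OF w] by (simp add: sum_list_sum_nth atLeast0LessThan)
    have len: "length w = n" by (rule length_replicate_pmf[OF w])
    have i: "letter_weight p g (y' (rv_X (w ! i)) (rv_Y (w ! i))) (g (rv_X (w ! i))) (rv_X (w ! i)) > 0 \<and>
        log b (letter_weight p g (y' (rv_X (w ! i)) (rv_Y (w ! i))) (g (rv_X (w ! i))) (rv_X (w ! i))) = - info (w ! i)"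
      if "i < n" for i
    proof -
      obtain x y z where wi: "w ! i = (x, y, z)" by (cases "w ! i")
      have "w ! i \<in> set_pmf P"
        using w that len by (simp add: set_replicate_pmf in_lists_conv_set)
      hence "x \<in> set_pmf p" "y = None \<or> y = Some x"
        using set_erasure_source[of p g \<epsilon>] by (auto simp: P_def wi)
      thus ?thesis
        using y'[of x y] posterior_pos[of x p g]
        by (auto simp: wi letter_weight_def info_def split: option.splits)
    qed
    let ?w = "\<lambda>i. letter_weight p g (y' (rv_X (w ! i)) (rv_Y (w ! i))) (g (rv_X (w ! i))) (rv_X (w ! i))"
    have "log b (\<Prod>i<n. ?w i) = - (\<Sum>i<n. info (w ! i))"
      using i by (subst log_prod) (auto simp: sum_negf)
    also have "\<dots> \<ge> - (n * (expect P info + \<eta>))"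
      using le by simp
    finally have "- (n * (expect P info + \<eta>)) \<le> log b (\<Prod>i<n. ?w i)" .
    moreover have "(\<Prod>i<n. ?w i) > 0" using i by (intro prod_pos) auto
    ultimately have "b powr (- (n * (expect P info + \<eta>))) \<le> (\<Prod>i<n. ?w i)"
      using b by (simp add: le_log_iff)
    hence "1 / ?T \<le> (\<Prod>i<n. ?w i)" by (simp add: powr_minus_divide)
    moreover have "(\<Prod>i<n. ?w i) = (\<Prod>i<n. letter_weight p g (map2 y' (map rv_X w) (map rv_Y w) ! i)
        (map g (map rv_X w) ! i) (map rv_X w ! i))"
      using len by (intro prod.cong) auto
    ultimately have "1 / ?T \<le> (\<Prod>i<n. letter_weight p g (map2 y' (map rv_X w) (map rv_Y w) ! i)
        (map g (map rv_X w) ! i) (map rv_X w ! i))"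
      by (simp only:)
    moreover have "length (map rv_X w) = n" using len by simp
    ultimately show False using notin unfolding likely_set_def mem_Collect_eq by blast
  qed
  have "measure_pmf.prob (erasure_block n p g \<epsilon>)
      {(x, y). x \<notin> likely_set p g n (1 / ?T) (map2 y' x y) (map g x)}
    = measure_pmf.prob (replicate_pmf n P) {w. map rv_X w \<notin>
       likely_set p g n (1 / ?T) (map2 y' (map rv_X w) (map rv_Y w)) (map g (map rv_X w))}"
    by (simp add: erasure_block_def P_def vimage_def)
  also have "\<dots> \<le> measure_pmf.prob (replicate_pmf n P) {w. (\<Sum>v\<leftarrow>w. info v) > n * (expect P info + \<eta>)}"
    using * by (intro measure_pmf.finite_measure_mono_AE) (auto simp: AE_measure_pmf_iff)
  also have "\<dots> \<le> expect P (\<lambda>w. (info w - expect P info)\<^sup>2) / (n * \<eta>\<^sup>2)"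
    by (rule prob_replicate_pmf_sum_gt) (use n \<eta> in auto)
  finally show ?thesis .
qed

subsection \<open>Binning\<close>

text \<open>The derandomised form of random binning: the bin of each new point is chosen such that the
  weight of the collisions with the points that have already been placed is at most average.\<close>

lemma exists_binning_weight:
  fixes w :: "'a \<Rightarrow> 'a \<Rightarrow> real"
  assumes "finite A" and w: "\<And>x y. w x y \<ge> 0" and M: "M > 0"
  shows "\<exists>c. (\<forall>x. c x < M) \<and>
    (\<Sum>x\<in>A. \<Sum>y\<in>A - {x}. w x y * of_bool (c x = c y)) \<le> (\<Sum>x\<in>A. \<Sum>y\<in>A - {x}. w x y) / real M"
  using assms(1)
proof (induction A)
  case empty
  then show ?case using M by auto
next
  case (insert a A)
  then obtain c where c: "\<And>x. c x < M"
    and le: "(\<Sum>x\<in>A. \<Sum>y\<in>A - {x}. w x y * of_bool (c x = c y)) \<le> (\<Sum>x\<in>A. \<Sum>y\<in>A - {x}. w x y) / real M"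
    by auto
  have split: "(\<Sum>x\<in>insert a A. \<Sum>y\<in>insert a A - {x}. f x y)
     = (\<Sum>x\<in>A. \<Sum>y\<in>A - {x}. f x y) + (\<Sum>x\<in>A. f a x + f x a)" for f :: "'a \<Rightarrow> 'a \<Rightarrow> real"
  proof -
    have "(\<Sum>y\<in>insert a A - {x}. f x y) = f x a + (\<Sum>y\<in>A - {x}. f x y)" if "x \<in> A" for x
      using insert.hyps that by (subst insert_Diff_if) auto
    moreover have "insert a A - {a} = A" using insert.hyps by auto
    ultimately show ?thesis
      using insert.hyps by (simp add: sum.distrib)
  qed
  \<comment> \<open>The weight of the new collisions if \<open>a\<close> goes to bin
    \<open>v\<close>. Each old point lies in exactly one bin, so these values add up to the full
    weight between \<open>a\<close> and \<open>A\<close>, and some bin is at most average.\<close>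
  define u where "u v = (\<Sum>x\<in>A. (w a x + w x a) * of_bool (v = c x))" for v
  have "(\<Sum>v<M. u v) = (\<Sum>x\<in>A. \<Sum>v<M. (w a x + w x a) * of_bool (v = c x))"
    unfolding u_def by (rule sum.swap)
  also have "\<dots> = (\<Sum>x\<in>A. w a x + w x a)"
    using c by (intro sum.cong refl) (simp flip: sum_distrib_left add: of_bool_def)
  finally have u: "(\<Sum>v<M. u v) = (\<Sum>x\<in>A. w a x + w x a)" .
  have "\<exists>v<M. u v \<le> (\<Sum>x\<in>A. w a x + w x a) / real M"
  proof (rule ccontr)
    assume "\<not> ?thesis"
    hence "(\<Sum>v<M. (\<Sum>x\<in>A. w a x + w x a) / real M) < (\<Sum>v<M. u v)"
      using M by (intro sum_strict_mono) auto
    thus False using M u by simp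
  qed
  then obtain v where v: "v < M" "u v \<le> (\<Sum>x\<in>A. w a x + w x a) / real M" by blast
  let ?c = "c(a := v)"
  have "(\<Sum>x\<in>A. \<Sum>y\<in>A - {x}. w x y * of_bool (?c x = ?c y)) = (\<Sum>x\<in>A. \<Sum>y\<in>A - {x}. w x y * of_bool (c x = c y))"
  proof (intro sum.cong refl)
    fix x y assume "x \<in> A" "y \<in> A - {x}"
    hence "?c x = c x" "?c y = c y" using insert.hyps by auto
    thus "w x y * of_bool (?c x = ?c y) = w x y * of_bool (c x = c y)" by (simp only:)
  qed
  moreover have "(\<Sum>x\<in>A. w a x * of_bool (?c a = ?c x) + w x a * of_bool (?c x = ?c a)) = u v"
    unfolding u_def
  proof (intro sum.cong refl)
    fix x assume "x \<in> A"
    hence "?c x = c x" "?c a = v" using insert.hyps by auto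
    thus "w a x * of_bool (?c a = ?c x) + w x a * of_bool (?c x = ?c a) = (w a x + w x a) * of_bool (v = c x)"
      by (simp only:) (auto simp: of_bool_def)
  qed
  ultimately have "(\<Sum>x\<in>insert a A. \<Sum>y\<in>insert a A - {x}. w x y * of_bool (?c x = ?c y))
     \<le> (\<Sum>x\<in>insert a A. \<Sum>y\<in>insert a A - {x}. w x y) / real M"
    unfolding split using le v by (simp add: add_divide_distrib)
  moreover have "\<forall>x. ?c x < M" using c v by simp
  ultimately show ?case by blast
qed

text \<open>One and the same \<open>c\<close> has to suit both weights, so it is chosen for the
  normalised sum \<open>w1 / T1 + w2 / T2\<close> of mass at most 2, whence the factor 2. Then
  \<open>h\<close> is chosen for the pairs that still collide under \<open>c\<close>.\<close>

lemma exists_two_binnings: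
  fixes w1 w2 :: "'a \<Rightarrow> 'a \<Rightarrow> real"
  assumes A: "finite A" and w: "\<And>x y. w1 x y \<ge> 0" "\<And>x y. w2 x y \<ge> 0" and L: "L > 0" and M: "M > 0"
    and T: "T1 > 0" "T2 > 0" "(\<Sum>x\<in>A. \<Sum>y\<in>A - {x}. w1 x y) \<le> T1" "(\<Sum>x\<in>A. \<Sum>y\<in>A - {x}. w2 x y) \<le> T2"
  shows "\<exists>c h. (\<forall>x. c x < L) \<and> (\<forall>x. h x < M) \<and>
    (\<Sum>x\<in>A. \<Sum>y\<in>A - {x}. w1 x y * of_bool (c x = c y)) \<le> 2 * T1 / real L \<and>
    (\<Sum>x\<in>A. \<Sum>y\<in>A - {x}. w2 x y * of_bool ((c x, h x) = (c y, h y))) \<le> 2 * T2 / (real L * real M)"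
proof -
  let ?s = "\<lambda>w :: 'a \<Rightarrow> 'a \<Rightarrow> real. \<Sum>x\<in>A. \<Sum>y\<in>A - {x}. w x y"
  have s_add: "?s (\<lambda>x y. f x y / T1 + f' x y / T2) = ?s f / T1 + ?s f' / T2" for f f'
    by (simp add: sum.distrib sum_divide_distrib)
  have s_nn: "?s (\<lambda>x y. w1 x y * of_bool (P x y)) \<ge> 0" "?s (\<lambda>x y. w2 x y * of_bool (P x y)) \<ge> 0" for P
    using w by (auto intro!: sum_nonneg)
  have "\<exists>c. (\<forall>x. c x < L) \<and>
    ?s (\<lambda>x y. (w1 x y / T1 + w2 x y / T2) * of_bool (c x = c y)) \<le> ?s (\<lambda>x y. w1 x y / T1 + w2 x y / T2) / real L"
    using A L w T by (intro exists_binning_weight) auto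
  then obtain c where c: "\<And>x. c x < L" and
    "?s (\<lambda>x y. (w1 x y / T1 + w2 x y / T2) * of_bool (c x = c y)) \<le> ?s (\<lambda>x y. w1 x y / T1 + w2 x y / T2) / real L"
    by auto
  note this(2)
  also have "?s (\<lambda>x y. w1 x y / T1 + w2 x y / T2) \<le> 1 + 1"
    unfolding s_add using T by (intro add_mono) auto
  hence "?s (\<lambda>x y. w1 x y / T1 + w2 x y / T2) / real L \<le> 2 / real L"
    by (intro divide_right_mono) auto
  finally have le: "?s (\<lambda>x y. w1 x y * of_bool (c x = c y)) / T1 + ?s (\<lambda>x y. w2 x y * of_bool (c x = c y)) / T2 \<le> 2 / real L"
    unfolding s_add[symmetric] by (simp add: algebra_simps)
  have "?s (\<lambda>x y. w1 x y * of_bool (c x = c y)) / T1 \<ge> 0" "?s (\<lambda>x y. w2 x y * of_bool (c x = c y)) / T2 \<ge> 0"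
    using s_nn T by (auto intro!: divide_nonneg_pos)
  hence le1: "?s (\<lambda>x y. w1 x y * of_bool (c x = c y)) \<le> 2 * T1 / real L"
    and le2: "?s (\<lambda>x y. w2 x y * of_bool (c x = c y)) \<le> 2 * T2 / real L"
  proof -
    have "?s (\<lambda>x y. w1 x y * of_bool (c x = c y)) / T1 \<le> 2 / real L"
      "?s (\<lambda>x y. w2 x y * of_bool (c x = c y)) / T2 \<le> 2 / real L"
      using le \<open>?s (\<lambda>x y. w1 x y * of_bool (c x = c y)) / T1 \<ge> 0\<close>
        \<open>?s (\<lambda>x y. w2 x y * of_bool (c x = c y)) / T2 \<ge> 0\<close> by linarith+
    thus "?s (\<lambda>x y. w1 x y * of_bool (c x = c y)) \<le> 2 * T1 / real L"
      "?s (\<lambda>x y. w2 x y * of_bool (c x = c y)) \<le> 2 * T2 / real L"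
      using T by (simp_all add: pos_divide_le_eq mult.commute)
  qed
  have "\<exists>h. (\<forall>x. h x < M) \<and> ?s (\<lambda>x y. (w2 x y * of_bool (c x = c y)) * of_bool (h x = h y))
      \<le> ?s (\<lambda>x y. w2 x y * of_bool (c x = c y)) / real M"
    using A M w by (intro exists_binning_weight) auto
  then obtain h where h: "\<And>x. h x < M" and
    "?s (\<lambda>x y. (w2 x y * of_bool (c x = c y)) * of_bool (h x = h y)) \<le> ?s (\<lambda>x y. w2 x y * of_bool (c x = c y)) / real M"
    by auto
  note this(2)
  also have "?s (\<lambda>x y. w2 x y * of_bool (c x = c y)) / real M \<le> 2 * T2 / real L / real M"
    using le2 by (intro divide_right_mono) auto
  finally have "?s (\<lambda>x y. w2 x y * of_bool ((c x, h x) = (c y, h y))) \<le> 2 * T2 / (real L * real M)"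
    by (simp add: of_bool_conj mult.assoc)
  with c h le1 show ?thesis by blast
qed

definition bin_decoder :: "('s \<Rightarrow> 'a set) \<Rightarrow> ('a \<Rightarrow> 'c) \<Rightarrow> 's \<Rightarrow> 'c \<Rightarrow> 'a" where
  "bin_decoder S c s j = (SOME x. x \<in> S s \<and> c x = j)"

text \<open>The probability that \<open>x\<close> is the true point while \<open>x'\<close> is among
  the candidates. The bins must be fixed before the side information \<open>s\<close> is known, so
  \<open>s\<close> is averaged out here.\<close>

definition confusion_weight :: "('a \<times> 's) pmf \<Rightarrow> ('s \<Rightarrow> 'a set) \<Rightarrow> 'a \<Rightarrow> 'a \<Rightarrow> real" where
  "confusion_weight D S x x' = expect D (\<lambda>(x0, s). of_bool (x0 = x \<and> x' \<in> S s))"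

lemma confusion_weight_nonneg: "confusion_weight D S x x' \<ge> 0"
  unfolding confusion_weight_def by (intro integral_nonneg_AE) (auto split: prod.split)

lemma confusion_weight_sum:
  fixes e :: "'a \<Rightarrow> 'a \<Rightarrow> real"
  assumes D: "finite (set_pmf D)" "fst ` set_pmf D \<subseteq> X" and X: "finite X"
  shows "(\<Sum>x\<in>X. \<Sum>x'\<in>X - {x}. confusion_weight D S x x' * e x x')
     = expect D (\<lambda>(x, s). \<Sum>x'\<in>X - {x}. of_bool (x' \<in> S s) * e x x')"
proof -
  have I: "integrable D f" for f :: "_ \<Rightarrow> real"
    using D(1) by (rule integrable_measure_pmf_finite)
  have "(\<Sum>x\<in>X. \<Sum>x'\<in>X - {x}. confusion_weight D S x x' * e x x')
    = expect D (\<lambda>w. \<Sum>x\<in>X. \<Sum>x'\<in>X - {x}. (case w of (x0, s) \<Rightarrow> of_bool (x0 = x \<and> x' \<in> S s)) * e x x')"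
    by (simp add: confusion_weight_def I)
  also have "\<dots> = expect D (\<lambda>(x, s). \<Sum>x'\<in>X - {x}. of_bool (x' \<in> S s) * e x x')"
  proof (rule expect_cong_pmf, clarify)
    fix x0 s assume "(x0, s) \<in> set_pmf D"
    hence "x0 \<in> X" using D by force
    have "(\<Sum>x\<in>X. \<Sum>x'\<in>X - {x}. of_bool (x0 = x \<and> x' \<in> S s) * e x x')
       = (\<Sum>x\<in>X. if x = x0 then (\<Sum>x'\<in>X - {x0}. of_bool (x' \<in> S s) * e x0 x') else 0)"
      by (intro sum.cong refl) auto
    also have "\<dots> = (\<Sum>x'\<in>X - {x0}. of_bool (x' \<in> S s) * e x0 x')"
      using \<open>x0 \<in> X\<close> X by simp
    finally show "(\<Sum>x\<in>X. \<Sum>x'\<in>X - {x}. of_bool (x0 = x \<and> x' \<in> S s) * e x x') =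
      (\<Sum>x'\<in>X - {x0}. of_bool (x' \<in> S s) * e x0 x')" .
  qed
  finally show ?thesis .
qed

text \<open>Each outcome \<open>(x, s)\<close> contributes the number of its wrong candidates, at
  most \<open>card (S s)\<close>.\<close>

lemma sum_confusion_weight_le:
  fixes T :: real
  assumes D: "finite (set_pmf D)" "fst ` set_pmf D \<subseteq> X" and X: "finite X" "\<And>s. S s \<subseteq> X"
    and T: "\<And>s. card (S s) \<le> T"
  shows "(\<Sum>x\<in>X. \<Sum>x'\<in>X - {x}. confusion_weight D S x x') \<le> T"
proof -
  have "(\<Sum>x\<in>X. \<Sum>x'\<in>X - {x}. confusion_weight D S x x')
     = expect D (\<lambda>(x, s). \<Sum>x'\<in>X - {x}. of_bool (x' \<in> S s))"
    using confusion_weight_sum[OF D X(1), of S "\<lambda>_ _. 1"] by simp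
  also have "\<dots> \<le> expect D (\<lambda>_. T)"
  proof (rule expect_mono_pmf[OF D(1)], clarify)
    fix x s
    have "(\<Sum>x'\<in>X - {x}. of_bool (x' \<in> S s)) \<le> (\<Sum>x'\<in>X. of_bool (x' \<in> S s) :: real)"
      using X by (intro sum_mono2) auto
    also have "\<dots> = card (S s)"
      using X by (simp add: of_bool_def sum.If_cases Int_absorb1 Int_commute)
    finally show "(\<Sum>x'\<in>X - {x}. of_bool (x' \<in> S s)) \<le> T"
      using T[of s] by linarith
  qed
  finally show ?thesis by simp
qed

text \<open>If the true point is a candidate and the decoder still errs, the point it picks is a
  second candidate in the same bin; a union bound over such candidates remains.\<close>

lemma prob_bin_decoder_error_le:
  assumes D: "finite (set_pmf D)" "fst ` set_pmf D \<subseteq> X" and X: "finite X" "\<And>s. S s \<subseteq> X"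
  shows "measure_pmf.prob D {(x, s). bin_decoder S c s (c x) \<noteq> x} \<le>
    measure_pmf.prob D {(x, s). x \<notin> S s} +
    (\<Sum>x\<in>X. \<Sum>x'\<in>X - {x}. confusion_weight D S x x' * of_bool (c x = c x'))"
proof -
  have I: "integrable D f" for f :: "_ \<Rightarrow> real"
    using D(1) by (rule integrable_measure_pmf_finite)
  let ?E = "{(x, s). bin_decoder S c s (c x) \<noteq> x}" and ?N = "{(x, s). x \<notin> S s}"
  let ?f = "\<lambda>(x, s). \<Sum>x'\<in>X - {x}. of_bool (x' \<in> S s) * of_bool (c x = c x') :: real"
  have "measure_pmf.prob D ?E = expect D (indicator ?E)" by simp
  also have "\<dots> \<le> expect D (\<lambda>w. indicator ?N w + ?f w)"
  proof (rule expect_mono_pmf[OF D(1)])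
    fix w assume w: "w \<in> set_pmf D"
    obtain x s where ws: "w = (x, s)" by fastforce
    have "x \<in> X" using w D by (force simp: ws)
    have f0: "?f w \<ge> 0" by (auto simp: ws intro!: sum_nonneg)
    show "indicator ?E w \<le> indicator ?N w + ?f w"
    proof (cases "w \<in> ?E \<and> w \<notin> ?N")
      case True
      let ?x' = "bin_decoder S c s (c x)"
      have "x \<in> S s \<and> c x = c x" using True by (simp add: ws)
      hence "?x' \<in> S s \<and> c ?x' = c x"
        unfolding bin_decoder_def by (rule someI)
      moreover have "?x' \<noteq> x" using True by (simp add: ws)
      ultimately have x': "?x' \<in> X - {x}" "?x' \<in> S s" "c x = c ?x'" using X by auto
      have "1 = of_bool (?x' \<in> S s) * (of_bool (c x = c ?x') :: real)" using x' by simp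
      also have "\<dots> \<le> ?f w"
        unfolding ws prod.case using x'(1) X by (intro member_le_sum) auto
      finally show ?thesis using True by simp
    qed (use f0 in \<open>auto simp: indicator_def\<close>)
  qed
  also have "\<dots> = measure_pmf.prob D ?N + expect D ?f"
    unfolding Bochner_Integration.integral_add[OF I I] by simp
  also have "expect D ?f = (\<Sum>x\<in>X. \<Sum>x'\<in>X - {x}. confusion_weight D S x x' * of_bool (c x = c x'))"
    by (rule confusion_weight_sum[OF D X(1), symmetric])
  finally show ?thesis .
qed

subsection \<open>The one-way protocol\<close>

lemma pmf_map_inj_on_set:
  assumes "inj_on f S" "A ` set_pmf Q \<subseteq> S" "w \<in> set_pmf Q"
  shows "pmf (map_pmf (\<lambda>w. f (A w)) Q) (f (A w)) = pmf (map_pmf A Q) (A w)"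
proof -
  have "pmf (map_pmf f (map_pmf A Q)) (f (A w)) = pmf (map_pmf A Q) (A w)"
    by (rule pmf_map_inj) (use assms in \<open>auto intro: inj_on_subset\<close>)
  thus ?thesis by (simp add: map_pmf_comp)
qed

text \<open>Since \<open>id\<close> determines all the other variables, the probability ratios
  telescope pointwise on the support.\<close>

lemma cond_ent_chain:
  assumes b: "1 < b" and fin: "finite (set_pmf Q)"
  shows "cond_ent b Q id Z = cond_ent b Q C Z + cond_ent b Q H (\<lambda>x. (C x, Z x))
    + cond_ent b Q id (\<lambda>x. (H x, C x, Z x))"
proof -
  have I: "integrable Q f" for f :: "_ \<Rightarrow> real"
    using fin by (rule integrable_measure_pmf_finite)
  have id_pair: "pmf (map_pmf (\<lambda>x. (id x, f x)) Q) (id x, f x) = pmf Q x" for x and f :: "_ \<Rightarrow> 'e"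
    using pmf_map_inj'[of "\<lambda>x. (id x, f x)" Q x] by (simp add: inj_on_def)
  have id_pair': "pmf (map_pmf (\<lambda>x. (id x, H x, C x, Z x)) Q) (id x, H x, C x, Z x) = pmf Q x" for x
    using pmf_map_inj'[of "\<lambda>x. (id x, H x, C x, Z x)" Q x] by (simp add: inj_on_def)
  show ?thesis
    unfolding cond_ent_eq_expect[OF b fin] Bochner_Integration.integral_add[OF I I, symmetric]
  proof (rule expect_cong_pmf)
    fix x assume x: "x \<in> set_pmf Q"
    note pos = pmf_map_pos[OF x, of Z] pmf_map_pos[OF x, of "\<lambda>x. (C x, Z x)"]
      pmf_map_pos[OF x, of "\<lambda>x. (H x, C x, Z x)"] pmf_positive[OF x]
    show "- log b (pmf (map_pmf (\<lambda>x. (id x, Z x)) Q) (id x, Z x) / pmf (map_pmf Z Q) (Z x)) =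
      - log b (pmf (map_pmf (\<lambda>x. (C x, Z x)) Q) (C x, Z x) / pmf (map_pmf Z Q) (Z x)) +
      - log b (pmf (map_pmf (\<lambda>x. (H x, C x, Z x)) Q) (H x, C x, Z x) / pmf (map_pmf (\<lambda>x. (C x, Z x)) Q) (C x, Z x)) +
      - log b (pmf (map_pmf (\<lambda>x. (id x, H x, C x, Z x)) Q) (id x, H x, C x, Z x) /
          pmf (map_pmf (\<lambda>x. (H x, C x, Z x)) Q) (H x, C x, Z x))"
      unfolding id_pair[of Z] id_pair' using pos by (simp add: log_divide_pos)
  qed
qed

lemma cond_ent_le_log_card:
  assumes b: "1 < b" and fin: "finite (set_pmf Q)" and C: "\<And>x. C x < (L::nat)"
  shows "cond_ent b Q C Z \<le> log b L"
proof -
  have L: "L > 0" using C by (metis gr_zeroI not_less_zero)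
  have "cond_ent b Q C Z \<le> expect Q (\<lambda>w. - log b ((\<lambda>_ _. 1 / real L) (C w) (Z w)))"
    by (rule cond_ent_le_expect[OF b fin, of "{..<L}"]) (use C L in auto)
  thus ?thesis using b L by (simp add: log_divide_pos)
qed

text \<open>Half of the guessing weight goes to the decoded value and half is spread over
  \<open>X\<close>. The crude constant \<open>log b 2\<close> disappears after division by the
  blocklength.\<close>

lemma cond_ent_id_le_fano:
  assumes b: "1 < b" and X: "finite X" "set_pmf Q \<subseteq> X"
  shows "cond_ent b Q id V \<le> log b 2 + measure_pmf.prob Q {x. d (V x) \<noteq> x} * log b (card X)"
proof -
  have fin: "finite (set_pmf Q)" using X by (rule finite_subset[rotated])
  have "X \<noteq> {}" using X set_pmf_not_empty[of Q] by auto
  hence N: "card X \<ge> 1" using X by (simp add: Suc_leI card_gt_0_iff)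
  define \<alpha> where "\<alpha> = (\<lambda>x v. if d v = x then 1 / 2 else 1 / (2 * real (card X)))"
  have "cond_ent b Q id V \<le> expect Q (\<lambda>x. - log b (\<alpha> (id x) (V x)))"
  proof (rule cond_ent_le_expect[OF b fin X(1)])
    show "\<alpha> (id x) (V x) > 0" for x using N by (auto simp: \<alpha>_def)
    show "\<alpha> a c \<ge> 0" for a c by (auto simp: \<alpha>_def)
    show "(\<Sum>a\<in>X. \<alpha> a v) \<le> 1" for v
    proof -
      have "(\<Sum>a\<in>X. \<alpha> a v) \<le> (\<Sum>a\<in>X. (if d v = a then 1 / 2 else 0) + 1 / (2 * real (card X)))"
        by (intro sum_mono) (auto simp: \<alpha>_def)
      also have "\<dots> = (\<Sum>a\<in>X. if d v = a then 1 / 2 else 0) + 1 / 2"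
        using N by (simp add: sum.distrib)
      also have "\<dots> \<le> 1" using X by simp
      finally show ?thesis .
    qed
  qed (use X in auto)
  also have "\<dots> \<le> expect Q (\<lambda>x. log b 2 + indicator {x. d (V x) \<noteq> x} x * log b (card X))"
    by (rule expect_mono_pmf[OF fin])
       (use N b in \<open>auto simp: \<alpha>_def log_divide_pos log_mult_pos\<close>)
  also have "\<dots> = log b 2 + measure_pmf.prob Q {x. d (V x) \<noteq> x} * log b (card X)"
  proof -
    have I: "integrable Q f" for f :: "_ \<Rightarrow> real"
      using fin by (rule integrable_measure_pmf_finite)
    show ?thesis unfolding Bochner_Integration.integral_add[OF I I] by simp
  qed
  finally show ?thesis .
qed

lemma cond_ent_replicate_pmf:
  fixes p :: "'x::finite pmf" and g :: "'x \<Rightarrow> 'z::finite"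
  assumes b: "1 < b"
  shows "cond_ent b (replicate_pmf n p) id (map g) = n * post_ent b p g"
proof -
  let ?W = "replicate_pmf n p"
  have fin: "finite (set_pmf ?W)" by (simp add: finite_set_replicate_pmf)
  have id_pair: "pmf (map_pmf (\<lambda>x. (id x, map g x)) ?W) (id x, map g x) = pmf ?W x" for x
    using pmf_map_inj'[of "\<lambda>x. (id x, map g x)" ?W x] by (simp add: inj_on_def)
  have "cond_ent b ?W id (map g) = expect ?W (\<lambda>x. \<Sum>v\<leftarrow>x. - log b (posterior p g v))"
    unfolding cond_ent_eq_expect[OF b fin] map_replicate_pmf id_pair
  proof (rule expect_cong_pmf)
    fix x assume x: "x \<in> set_pmf ?W"
    have len: "length x = n" by (rule length_replicate_pmf[OF x])
    have "x ! i \<in> set_pmf p" if "i < n" for i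
      using x that len by (simp add: set_replicate_pmf in_lists_conv_set)
    hence i: "posterior p g (x ! i) > 0" if "i < n" for i
      using that by (simp add: posterior_pos)
    have "pmf ?W x / pmf (replicate_pmf n (map_pmf g p)) (map g x) = (\<Prod>i<n. posterior p g (x ! i))"
      using len by (simp add: pmf_replicate_pmf posterior_def prod_dividef)
    hence "- log b (pmf ?W x / pmf (replicate_pmf n (map_pmf g p)) (map g x)) = - (\<Sum>i<n. log b (posterior p g (x ! i)))"
      by (simp only:) (subst log_prod, auto intro: i)
    thus "- log b (pmf ?W x / pmf (replicate_pmf n (map_pmf g p)) (map g x)) = (\<Sum>v\<leftarrow>x. - log b (posterior p g v))"
      using len by (simp add: sum_list_sum_nth atLeast0LessThan sum_negf)
  qed
  also have "\<dots> = n * post_ent b p g"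
    unfolding post_ent_def by (rule expect_replicate_pmf_sum) simp
  finally show ?thesis .
qed

text \<open>Validity quantifies over observations of every length, so \<open>take n\<close> keeps
  the message alphabet finite; on blocks of length \<open>n\<close> it is the identity. The message
  is a triple coded by \<open>to_nat\<close>, which both key functions decode from
  \<open>hd f\<close>.\<close>

definition pad_protocol ::
  "nat \<Rightarrow> nat \<Rightarrow> nat \<Rightarrow> ('x \<Rightarrow> 'z::finite) \<Rightarrow> ('x list \<Rightarrow> nat) \<Rightarrow> ('x list \<Rightarrow> nat) \<Rightarrow>
    ('x option list \<Rightarrow> 'z list \<Rightarrow> nat \<Rightarrow> 'x list) \<Rightarrow> ('x, 'x option) protocol" where
  "pad_protocol n L M g c h d =
    \<lparr>rounds = 1,
     msg_alphabet = to_nat ` ({z :: 'z list. length z \<le> n} \<times> {..<L} \<times> {..<M}),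
     key_alphabet = {..<M},
     alice_msg = (\<lambda>x f. map_pmf (\<lambda>u. to_nat (take n (map g x), c x, u)) (pmf_of_set {..<M})),
     bob_msg = (\<lambda>y f. return_pmf (to_nat ([] :: 'z list, 0 :: nat, 0 :: nat))),
     alice_key = (\<lambda>x f. case from_nat (hd f) :: 'z list \<times> nat \<times> nat of
       (z, j, u) \<Rightarrow> return_pmf ((u + h x) mod M)),
     bob_key = (\<lambda>y f. case from_nat (hd f) of (z, j, u) \<Rightarrow> return_pmf ((u + h (d y z j)) mod M))\<rparr>"

lemma valid_pad_protocol:
  assumes "L > 0" "M > 0" "\<And>x. c x < L"
  shows "valid_protocol (pad_protocol n L M (g :: 'x \<Rightarrow> 'z::finite) c h d)"
proof -
  have "finite {z :: 'z list. length z \<le> n}"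
    using finite_lists_length_le[of "UNIV :: 'z set" n] by simp
  thus ?thesis using assms
    by (auto simp: valid_protocol_def pad_protocol_def set_pmf_of_set lessThan_empty_iff split: prod.splits)
qed

lemma add_mod_inj:
  fixes M :: nat
  assumes "u < M" "v < M" "(u + k) mod M = (v + k) mod M"
  shows "u = v"
proof -
  have le: "s \<le> r" if "s < M" "(s + k) mod M = (r + k) mod M" for s r
  proof (rule ccontr)
    assume "\<not> s \<le> r"
    hence "M dvd s - r"
      using that(2) mod_eq_dvd_iff_nat[of "r + k" "s + k" M] by simp
    thus False using \<open>\<not> s \<le> r\<close> that(1) by (auto dest: dvd_imp_le)
  qed
  show ?thesis using le[of u v] le[of v u] assms by simp
qed

lemma map_add_mod_uniform:
  assumes "M > 0"
  shows "map_pmf (\<lambda>u. (u + k) mod M) (pmf_of_set {..<M}) = pmf_of_set {..<M :: nat}"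
proof (rule map_pmf_of_set_bij_betw)
  have inj: "inj_on (\<lambda>u. (u + k) mod M) {..<M}"
    by (rule inj_onI) (use add_mod_inj in auto)
  moreover have "(\<lambda>u. (u + k) mod M) ` {..<M} \<subseteq> {..<M}" using assms by auto
  ultimately show "bij_betw (\<lambda>u. (u + k) mod M) {..<M} {..<M}"
    by (metis bij_betw_def endo_inj_surj finite_lessThan)
qed (use assms in auto)

text \<open>Adding the fresh uniform \<open>u\<close>, which is public, makes Alice's key exactly uniform, so that its
  rate is exactly \<open>log b M / n\<close>; what Eve learns about the key is what she learns about \<open>h x\<close>.\<close>

lemma is_code_pad_protocol:
  fixes p :: "'x::finite pmf" and g :: "'x \<Rightarrow> 'z::finite"
  assumes b: "1 < b" and n: "n > 0" and LM: "L > 0" "M > 0" and c: "\<And>x. c x < L" and h: "\<And>x. h x < M"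
    and bob: "measure_pmf.prob (erasure_block n p g \<epsilon>) {(x, y). d y (map g x) (c x) \<noteq> x} \<le> \<delta>"
    and eve: "measure_pmf.prob (replicate_pmf n p) {x. d' (map g x) (c x) (h x) \<noteq> x} \<le> e"
    and leak: "log b M + log b L - n * post_ent b p g + log b 2 + e * (n * log b CARD('x)) \<le> n * \<delta>"
    and \<delta>: "\<delta> \<ge> 0"
  shows "is_code b (erasure_source p g \<epsilon>) n (log b M / n) \<delta> (pad_protocol n L M g c h d)"
proof -
  let ?\<pi> = "pad_protocol n L M g c h d"
  let ?Q = "protocol_law (erasure_source p g \<epsilon>) n ?\<pi>"
  define D where "D = erasure_block n p g \<epsilon>"
  define U where "U = pmf_of_set {..<M}"
  define B where "B = pair_pmf D U"
  have setU: "set_pmf U = {..<M}" unfolding U_def using LM by (intro set_pmf_of_set) auto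
  have valid: "valid_protocol ?\<pi>" by (rule valid_pad_protocol[OF LM c])
  have finD: "finite (set_pmf D)" unfolding D_def by (rule finite_erasure_block)
  have finB: "finite (set_pmf B)" using finD by (simp add: B_def setU)
  define \<Psi> where "\<Psi> = (\<lambda>((x, y), u). ((x, y, map g x), [to_nat (map g x, c x, u)],
      (u + h x) mod M, (u + h (d y (map g x) (c x))) mod M))"
  have Q: "?Q = map_pmf \<Psi> B"
  proof -
    have "run_law D ?\<pi> = D \<bind> (\<lambda>(x, y). U \<bind> (\<lambda>u. return_pmf ((x, y), [to_nat (map g x, c x, u)],
      (u + h x) mod M, (u + h (d y (map g x) (c x))) mod M)))"
      unfolding run_law_def
    proof (intro bind_pmf_cong refl, clarify)
      fix x y assume "(x, y) \<in> set_pmf D"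
      hence "take n (map g x) = map g x"
        using length_erasure_block[of x y n p g \<epsilon>] by (simp add: D_def)
      thus "map_pmf (Pair (x, y)) (transcript ?\<pi> (fst (x, y)) (snd (x, y)) (rounds ?\<pi>) \<bind>
         (\<lambda>f. map_pmf (Pair f) (pair_pmf (alice_key ?\<pi> (fst (x, y)) f) (bob_key ?\<pi> (snd (x, y)) f)))) =
        U \<bind> (\<lambda>u. return_pmf ((x, y), [to_nat (map g x, c x, u)],
          (u + h x) mod M, (u + h (d y (map g x) (c x))) mod M))"
        by (simp add: pad_protocol_def U_def bind_assoc_pmf bind_return_pmf bind_map_pmf map_bind_pmf pair_return_pmf1)
    qed
    thus ?thesis
      unfolding protocol_law_eq_map D_def[symmetric] B_def pair_pmf_def \<Psi>_def
      by (simp add: map_bind_pmf bind_assoc_pmf bind_return_pmf case_prod_unfold)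
  qed
  define kA where "kA = (\<lambda>((x, y :: 'x option list), u :: nat). (u + h x) mod M)"
  define v where "v = (\<lambda>((x, y :: 'x option list), u :: nat). (map g x, [to_nat (map g x, c x, u)]))"
  have KA: "(\<lambda>w. key_A (\<Psi> w)) = kA" and V: "(\<lambda>w. eve_view (\<Psi> w)) = v"
    by (auto simp: fun_eq_iff \<Psi>_def key_A_def eve_view_def kA_def v_def)
  have finQ: "finite (set_pmf ?Q)" using finB by (simp add: Q)

  have "map_pmf key_A ?Q = map_pmf kA B"
    by (simp add: Q map_pmf_comp KA)
  also have "\<dots> = D \<bind> (\<lambda>(x, y). map_pmf (\<lambda>u. (u + h x) mod M) U)"
    by (simp add: B_def pair_pmf_def kA_def map_pmf_def bind_assoc_pmf bind_return_pmf case_prod_unfold)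
  also have "\<dots> = U"
    by (simp add: U_def map_add_mod_uniform[OF LM(2)] case_prod_unfold)
  finally have key_A: "map_pmf key_A ?Q = U" .
  have ent: "ent b ?Q key_A = log b M"
  proof -
    have "ent b ?Q key_A = expect (map_pmf key_A ?Q) (\<lambda>k. - log b (pmf U k))"
      unfolding ent_eq_expect[OF b finQ] key_A by (simp flip: key_A)
    also have "\<dots> = expect U (\<lambda>_. log b M)"
      unfolding key_A
      by (rule expect_cong_pmf) (use LM b in \<open>auto simp: setU U_def indicator_def log_divide_pos lessThan_empty_iff\<close>)
    finally show ?thesis by simp
  qed

  \<comment> \<open>Key with view, and view alone, after the pad is stripped off. Both joint laws
    with \<open>u\<close> then carry the same factor \<open>1 / M\<close>, which cancels in the
    conditional probability.\<close>
  define T where "T = (\<lambda>x. (h x, c x, map g x))"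
  define T' where "T' = (\<lambda>x. (c x, map g x))"
  have pair: "map_pmf (\<lambda>((x, y), u). (F x, u)) B = pair_pmf (map_pmf F (replicate_pmf n p)) U" for F :: "'x list \<Rightarrow> 'e"
  proof -
    have "map_pmf (\<lambda>((x, y), u). (F x, u)) B = pair_pmf (map_pmf (\<lambda>(x, y). F x) D) (map_pmf id U)"
      by (simp add: B_def map_pair[symmetric] case_prod_unfold del: map_pmf_id)
    moreover have "map_pmf (\<lambda>(x, y). F x) D = map_pmf F (map_pmf fst D)"
      by (simp add: map_pmf_comp case_prod_unfold)
    ultimately show ?thesis
      by (simp add: D_def map_fst_erasure_block)
  qed
  have pmfU: "pmf U u = 1 / M" if "u < M" for u
    using that LM by (simp add: U_def lessThan_empty_iff)
  have "cond_ent b ?Q key_A eve_view = cond_ent b B kA v"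
    unfolding Q cond_ent_map_pmf[OF b finB] KA V ..
  also have "\<dots> = expect B (\<lambda>w. - log b (pmf (map_pmf T (replicate_pmf n p)) (T (fst (fst w))) /
       pmf (map_pmf T' (replicate_pmf n p)) (T' (fst (fst w)))))"
    unfolding cond_ent_eq_expect[OF b finB]
  proof (rule expect_cong_pmf)
    fix w assume w: "w \<in> set_pmf B"
    obtain x y u where xyu: "w = ((x, y), u)" by (cases w) auto
    have u: "u < M" using w by (auto simp: B_def xyu setU)
    let ?f = "\<lambda>((hh, cc :: nat, zz :: 'z list), u). ((u + hh) mod M, zz, [to_nat (zz, cc, u)])"
    let ?f' = "\<lambda>((cc :: nat, zz :: 'z list), u :: nat). (zz, [to_nat (zz, cc, u)])"
    \<comment> \<open>Given the public \<open>u\<close>, the key determines \<open>h x\<close> only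
      modulo \<open>M\<close>; the bound \<open>hh < M\<close> makes this exact.\<close>
    have "inj_on ?f ({(hh, cc, zz). hh < M} \<times> {..<M})"
    proof (rule inj_onI, clarify)
      fix h1 c1 u1 h2 c2 u2 :: nat and z1 z2 :: "'z list"
      assume "h1 < M" "h2 < M" and eq: "(u1 + h1) mod M = (u2 + h2) mod M"
        "to_nat (z1, c1, u1) = to_nat (z2, c2, u2)"
      hence "z1 = z2" "c1 = c2" "u1 = u2" by auto
      with eq have "(h1 + u1) mod M = (h2 + u1) mod M" by (simp add: add.commute)
      with \<open>h1 < M\<close> \<open>h2 < M\<close> have "h1 = h2" by (rule add_mod_inj)
      with \<open>z1 = z2\<close> \<open>c1 = c2\<close> \<open>u1 = u2\<close>
      show "((h1, c1, z1) = (h2, c2, z2)) \<and> u1 = u2" by simp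
    qed
    moreover have "(\<lambda>((x, y), u). (T x, u)) ` set_pmf B \<subseteq> {(hh, cc, zz). hh < M} \<times> {..<M}"
      by (auto simp: T_def h B_def setU)
    ultimately have "pmf (map_pmf (\<lambda>w. ?f ((\<lambda>((x, y), u). (T x, u)) w)) B) (?f ((\<lambda>((x, y), u). (T x, u)) w)) =
       pmf (map_pmf (\<lambda>((x, y), u). (T x, u)) B) ((\<lambda>((x, y), u). (T x, u)) w)"
      using w by (rule pmf_map_inj_on_set)
    moreover have "(\<lambda>w. ?f ((\<lambda>((x, y), u). (T x, u)) w)) = (\<lambda>w. (kA w, v w))"
      by (auto simp: fun_eq_iff T_def kA_def v_def)
    ultimately have 1: "pmf (map_pmf (\<lambda>w. (kA w, v w)) B) (kA w, v w) = pmf (map_pmf T (replicate_pmf n p)) (T x) * (1 / M)"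
      unfolding pair by (simp add: xyu pmf_pair pmfU[OF u] T_def kA_def v_def)
    have "inj_on ?f' UNIV" by (auto simp: inj_on_def)
    moreover have "(\<lambda>((x, y), u). (T' x, u)) ` set_pmf B \<subseteq> UNIV" by simp
    ultimately have "pmf (map_pmf (\<lambda>w. ?f' ((\<lambda>((x, y), u). (T' x, u)) w)) B) (?f' ((\<lambda>((x, y), u). (T' x, u)) w)) =
       pmf (map_pmf (\<lambda>((x, y), u). (T' x, u)) B) ((\<lambda>((x, y), u). (T' x, u)) w)"
      using w by (rule pmf_map_inj_on_set)
    moreover have "(\<lambda>w. ?f' ((\<lambda>((x, y), u). (T' x, u)) w)) = v"
      by (auto simp: fun_eq_iff T'_def v_def)
    ultimately have 2: "pmf (map_pmf v B) (v w) = pmf (map_pmf T' (replicate_pmf n p)) (T' x) * (1 / M)"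
      unfolding pair by (simp add: xyu pmf_pair pmfU[OF u] T'_def v_def)
    show "- log b (pmf (map_pmf (\<lambda>w. (kA w, v w)) B) (kA w, v w) / pmf (map_pmf v B) (v w)) =
       - log b (pmf (map_pmf T (replicate_pmf n p)) (T (fst (fst w))) /
       pmf (map_pmf T' (replicate_pmf n p)) (T' (fst (fst w))))"
      unfolding 1 2 using LM by (simp add: xyu)
  qed
  also have "\<dots> = expect (map_pmf (\<lambda>w. fst (fst w)) B) (\<lambda>x. - log b (pmf (map_pmf T (replicate_pmf n p)) (T x) /
       pmf (map_pmf T' (replicate_pmf n p)) (T' x)))"
    by simp
  also have "map_pmf (\<lambda>w. fst (fst w)) B = replicate_pmf n p"
  proof -
    have "map_pmf (\<lambda>w. fst (fst w)) B = map_pmf fst (map_pmf fst B)"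
      by (simp add: map_pmf_comp)
    thus ?thesis by (simp add: B_def map_fst_pair_pmf D_def map_fst_erasure_block)
  qed
  also have "expect (replicate_pmf n p) (\<lambda>x. - log b (pmf (map_pmf T (replicate_pmf n p)) (T x) /
       pmf (map_pmf T' (replicate_pmf n p)) (T' x))) = cond_ent b (replicate_pmf n p) h T'"
    unfolding T_def T'_def by (subst cond_ent_eq_expect[OF b]) (auto simp: finite_set_replicate_pmf)
  finally have cond_key: "cond_ent b ?Q key_A eve_view = cond_ent b (replicate_pmf n p) h T'" .

  let ?W = "replicate_pmf n p"
  let ?X = "{x :: 'x list. length x = n}"
  have finW: "finite (set_pmf ?W)" by (simp add: finite_set_replicate_pmf)
  have cardX: "card ?X = CARD('x) ^ n"
    using card_lists_length_eq[of "UNIV :: 'x set" n] by simp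
  \<comment> \<open>\<open>d'\<close> is a decoder of the analysis only, given \<open>h x\<close>
    besides Eve's \<open>z\<close> and \<open>c x\<close>. As it nearly always recovers
    \<open>x\<close>, the last term of the chain rule is small and the equivocation of
    \<open>h x\<close> must be large.\<close>
  have "cond_ent b ?W id (\<lambda>x. (h x, c x, map g x)) \<le> log b 2 +
      measure_pmf.prob ?W {x. (\<lambda>(hh, cc, zz). d' zz cc hh) (h x, c x, map g x) \<noteq> x} * log b (card ?X)"
    by (rule cond_ent_id_le_fano[OF b finite_lists_length]) (auto simp: length_replicate_pmf)
  also have "\<dots> \<le> log b 2 + e * (n * log b CARD('x))"
    using eve b order_trans[OF measure_nonneg eve]
    by (intro add_left_mono mult_mono) (auto simp: cardX log_nat_power Suc_leI)
  finally have "n * post_ent b p g \<le> log b L + cond_ent b ?W h T' + (log b 2 + e * (n * log b CARD('x)))"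
    using cond_ent_chain[OF b finW, of "map g" c h] cond_ent_le_log_card[OF b finW, of c L "map g"] c
    by (simp add: cond_ent_replicate_pmf[OF b] T'_def)
  hence mut: "mut_inf b ?Q key_A eve_view \<le> n * \<delta>"
    using ent_minus_mut_inf[OF b finQ, of key_A eve_view] leak by (simp add: ent cond_key)

  have "1 - \<delta> \<le> 1 - measure_pmf.prob D {(x, y). d y (map g x) (c x) \<noteq> x}"
    using bob by (simp add: D_def)
  also have "\<dots> = measure_pmf.prob D {(x, y). d y (map g x) (c x) = x}"
    using measure_pmf.prob_compl[of "{(x, y). d y (map g x) (c x) \<noteq> x}" D]
    by (simp add: Compl_eq_Diff_UNIV[symmetric] Collect_neg_eq[symmetric] case_prod_unfold)
  also have "\<dots> = measure_pmf.prob (map_pmf fst B) {(x, y). d y (map g x) (c x) = x}"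
    by (simp add: B_def map_fst_pair_pmf)
  also have "\<dots> = measure_pmf.prob B {((x, y), u). d y (map g x) (c x) = x}"
    by (simp add: vimage_def case_prod_unfold)
  also have "\<dots> \<le> measure_pmf.prob B {w. key_A (\<Psi> w) = key_B (\<Psi> w)}"
    by (intro measure_pmf.finite_measure_mono) (auto simp: \<Psi>_def key_A_def key_B_def)
  also have "\<dots> = measure_pmf.prob ?Q {\<omega>. key_A \<omega> = key_B \<omega>}"
    by (simp add: Q vimage_def)
  finally have agree: "1 - \<delta> \<le> measure_pmf.prob ?Q {\<omega>. key_A \<omega> = key_B \<omega>}" .
  have "card (key_alphabet ?\<pi>) = M" by (simp add: pad_protocol_def)
  thus ?thesis
    unfolding is_code_def using n valid ent agree mut \<delta>
    by (simp add: divide_le_eq mult.commute)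
qed

subsection \<open>The capacity\<close>

text \<open>Bob decodes from \<open>(y, z)\<close> and the bin under \<open>c\<close>, the
  hypothetical decoder from \<open>z\<close> alone and the bin under the pair of \<open>c\<close>
  and \<open>h\<close>. The two share \<open>c\<close>, which is why both collision weights are
  controlled at once.\<close>

lemma exists_hash_functions:
  fixes p :: "'x::finite pmf" and g :: "'x \<Rightarrow> 'z::finite" and T1 T2 :: real
  assumes LM: "L > 0" "M > 0" and T: "T1 > 0" "T2 > 0"
  shows "\<exists>c h d d'. (\<forall>x. c x < L) \<and> (\<forall>x. h x < M) \<and>
    measure_pmf.prob (erasure_block n p g \<epsilon>) {(x, y). d y (map g x) (c x) \<noteq> x}
      \<le> measure_pmf.prob (erasure_block n p g \<epsilon>)
          {(x, y). x \<notin> likely_set p g n (1 / T1) (map2 (\<lambda>_ y. y) x y) (map g x)} + 2 * T1 / L \<and>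
    measure_pmf.prob (replicate_pmf n p) {x. d' (map g x) (c x) (h x) \<noteq> x}
      \<le> measure_pmf.prob (erasure_block n p g \<epsilon>)
          {(x, y). x \<notin> likely_set p g n (1 / T2) (map2 (\<lambda>_ _. None) x y) (map g x)} + 2 * T2 / (real L * real M)"
proof -
  define D where "D = erasure_block n p g \<epsilon>"
  define X where "X = {x :: 'x list. length x = n}"
  define D1 where "D1 = map_pmf (\<lambda>(x, y). (x, y, map g x)) D"
  define D2 where "D2 = map_pmf (\<lambda>(x, y). (x, map g x)) D"
  define S1 where "S1 = (\<lambda>(y, z). likely_set p g n (1 / T1) y z)"
  define S2 where "S2 = (\<lambda>z. likely_set p g n (1 / T2) (replicate n None) z)"
  have D: "finite (set_pmf D)" unfolding D_def by (rule finite_erasure_block)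
  have len: "length x = n" "length y = n" if "(x, y) \<in> set_pmf D" for x y
    using length_erasure_block[of x y n p g \<epsilon>] that by (auto simp: D_def)
  have X: "finite X" unfolding X_def by (rule finite_lists_length)
  have D1: "finite (set_pmf D1)" "fst ` set_pmf D1 \<subseteq> X" and D2: "finite (set_pmf D2)" "fst ` set_pmf D2 \<subseteq> X"
    using D by (auto simp: D1_def D2_def X_def len)
  have S: "S1 s \<subseteq> X" "S2 z \<subseteq> X" for s z
    by (auto simp: S1_def S2_def likely_set_def X_def)
  have card: "card (S1 s) \<le> T1" "card (S2 z) \<le> T2" for s z
    using T by (auto simp: S1_def S2_def card_likely_set_le split: prod.split)
  from exists_two_binnings[OF X confusion_weight_nonneg confusion_weight_nonneg LM T
    sum_confusion_weight_le[where S=S1, OF D1 X S(1) card(1)] sum_confusion_weight_le[where S=S2, OF D2 X S(2) card(2)]]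
  obtain c h where c: "\<And>x. c x < L" and h: "\<And>x. h x < M" and
    le1: "(\<Sum>x\<in>X. \<Sum>x'\<in>X - {x}. confusion_weight D1 S1 x x' * of_bool (c x = c x')) \<le> 2 * T1 / L" and
    le2: "(\<Sum>x\<in>X. \<Sum>x'\<in>X - {x}. confusion_weight D2 S2 x x' * of_bool ((c x, h x) = (c x', h x')))
       \<le> 2 * T2 / (real L * real M)"
    by blast
  define d where "d = (\<lambda>y z j. bin_decoder S1 c (y, z) j)"
  define d' where "d' = (\<lambda>z j k. bin_decoder S2 (\<lambda>x. (c x, h x)) z (j, k))"
  have "measure_pmf.prob D {(x, y). d y (map g x) (c x) \<noteq> x}
      = measure_pmf.prob D1 {(x, s). bin_decoder S1 c s (c x) \<noteq> x}"
    by (simp add: D1_def d_def vimage_def case_prod_unfold)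
  also have "\<dots> \<le> measure_pmf.prob D1 {(x, s). x \<notin> S1 s} + 2 * T1 / L"
    using prob_bin_decoder_error_le[where S=S1 and c=c, OF D1 X S(1)] le1 by linarith
  also have "measure_pmf.prob D1 {(x, s). x \<notin> S1 s} = measure_pmf.prob D
       {(x, y). x \<notin> likely_set p g n (1 / T1) (map2 (\<lambda>_ y. y) x y) (map g x)}"
  proof -
    have "map2 (\<lambda>_ y. y) x y = y" if "(x, y) \<in> set_pmf D" for x y
      using len[OF that] by (simp add: map_snd_zip[unfolded snd_def])
    thus ?thesis
      unfolding D1_def measure_map_pmf
      by (intro measure_pmf.finite_measure_eq_AE) (auto simp: AE_measure_pmf_iff S1_def)
  qed
  finally have 1: "measure_pmf.prob D {(x, y). d y (map g x) (c x) \<noteq> x} \<le> measure_pmf.prob D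
       {(x, y). x \<notin> likely_set p g n (1 / T1) (map2 (\<lambda>_ y. y) x y) (map g x)} + 2 * T1 / L" .
  have "measure_pmf.prob (replicate_pmf n p) {x. d' (map g x) (c x) (h x) \<noteq> x}
      = measure_pmf.prob D2 {(x, s). bin_decoder S2 (\<lambda>x. (c x, h x)) s (c x, h x) \<noteq> x}"
    unfolding map_fst_erasure_block[of n p g \<epsilon>, symmetric]
    by (simp add: D2_def D_def d'_def vimage_def case_prod_unfold)
  also have "\<dots> \<le> measure_pmf.prob D2 {(x, s). x \<notin> S2 s} + 2 * T2 / (real L * real M)"
    using prob_bin_decoder_error_le[where S=S2 and c="\<lambda>x. (c x, h x)", OF D2 X S(2)] le2 by linarith
  also have "measure_pmf.prob D2 {(x, s). x \<notin> S2 s} = measure_pmf.prob D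
       {(x, y). x \<notin> likely_set p g n (1 / T2) (map2 (\<lambda>_ _. None) x y) (map g x)}"
  proof -
    have "map2 (\<lambda>_ _. None :: 'x option) x y = replicate n None" if "(x, y) \<in> set_pmf D" for x y
      using len[OF that] by (simp add: case_prod_unfold map_replicate_const)
    thus ?thesis
      unfolding D2_def measure_map_pmf
      by (intro measure_pmf.finite_measure_eq_AE) (auto simp: AE_measure_pmf_iff S2_def)
  qed
  finally have 2: "measure_pmf.prob (replicate_pmf n p) {x. d' (map g x) (c x) (h x) \<noteq> x} \<le> measure_pmf.prob D
       {(x, y). x \<notin> likely_set p g n (1 / T2) (map2 (\<lambda>_ _. None) x y) (map g x)} + 2 * T2 / (real L * real M)" .
  show ?thesis
    using c h 1 2 unfolding D_def by blast
qed

text \<open>The form of \<open>R\<close> makes \<open>n * R\<close> the logarithm of a power of two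
  whenever \<open>k\<close> divides \<open>n\<close>, so the required rate is met exactly.\<close>

lemma exists_code:
  fixes p :: "'x::finite pmf" and g :: "'x \<Rightarrow> 'z::finite" and a k :: nat
  assumes \<epsilon>: "0 \<le> \<epsilon>" "\<epsilon> \<le> 1" and b: "1 < b" and k: "k > 0" and \<delta>: "\<delta> > 0"
    and R: "R = a * log b 2 / k" "R \<le> (1 - \<epsilon>) * post_ent b p g"
  shows "\<exists>n. \<exists>\<pi>\<in>{\<pi>. rounds \<pi> = 1}. is_code b (erasure_source p g \<epsilon>) n R \<delta> \<pi>"
proof -
  let ?H = "post_ent b p g" and ?P = "erasure_source p g \<epsilon>" and ?N = "log b CARD('x)"
  \<comment> \<open>The leakage per letter will be at most
    \<open>2 * log b 2 / n + 3 * \<eta> + e n * ?N\<close>, which tends to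
    \<open>3 * \<eta>\<close>, that is, to half of \<open>\<delta>\<close>.\<close>
  define \<eta> where "\<eta> = \<delta> / 6"
  have \<eta>: "\<eta> > 0" using \<delta> by (simp add: \<eta>_def)
  define info1 where "info1 = (\<lambda>(x, y :: 'x option, z :: 'z). case y of None \<Rightarrow> - log b (posterior p g x) | Some _ \<Rightarrow> 0)"
  define info2 where "info2 = (\<lambda>(x, y :: 'x option, z :: 'z). - log b (posterior p g x))"
  have mean1: "expect ?P info1 = \<epsilon> * ?H" and mean2: "expect ?P info2 = ?H"
    by (simp_all add: expect_erasure_source[OF \<epsilon>] info1_def info2_def post_ent_def algebra_simps)
  define V where "V = max (expect ?P (\<lambda>w. (info1 w - \<epsilon> * ?H)\<^sup>2)) (expect ?P (\<lambda>w. (info2 w - ?H)\<^sup>2))"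
  \<comment> \<open>A common error bound for both decoders: Chebyshev's term for a block outside its
    likely set, plus the collision term.\<close>
  define e where "e n = V / (real n * \<eta>\<^sup>2) + 2 * b powr (- 2 * real n * \<eta>)" for n
  have H: "?H \<ge> 0" using b by (rule post_ent_nonneg)

  have "e \<longlonglongrightarrow> 0 + 2 * 0"
    unfolding e_def
  proof (intro tendsto_intros)
    show "(\<lambda>n. V / (real n * \<eta>\<^sup>2)) \<longlonglongrightarrow> 0"
      using \<eta> by real_asymp
    have "(\<lambda>n. (b powr (- 2 * \<eta>)) ^ n) \<longlonglongrightarrow> 0"
      using b \<eta> by (intro LIMSEQ_power_zero) (simp add: powr_less_one)
    thus "(\<lambda>n. b powr (- 2 * real n * \<eta>)) \<longlonglongrightarrow> 0"
      using b by (simp add: powr_power mult_ac)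
  qed
  hence e_lim: "e \<longlonglongrightarrow> 0" by simp
  have "(\<lambda>n. 2 * log b 2 / real n + 3 * \<eta> + e n * ?N) \<longlonglongrightarrow> 0 + 3 * \<eta> + 0 * ?N"
    by (intro tendsto_intros e_lim)
  hence "eventually (\<lambda>n. 2 * log b 2 / real n + 3 * \<eta> + e n * ?N < \<delta>) sequentially"
    by (rule order_tendstoD) (use \<delta> in \<open>simp add: \<eta>_def\<close>)
  moreover have "eventually (\<lambda>n. e n < \<delta>) sequentially"
    using e_lim \<delta> by (rule order_tendstoD)
  ultimately have "eventually (\<lambda>n. 2 * log b 2 / real n + 3 * \<eta> + e n * ?N < \<delta> \<and> e n < \<delta>) sequentially"
    by (rule eventually_conj)
  then obtain n0 where n0: "\<And>n. n \<ge> n0 \<Longrightarrow> 2 * log b 2 / real n + 3 * \<eta> + e n * ?N < \<delta> \<and> e n < \<delta>"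
    by (auto simp: eventually_sequentially)

  define n where "n = k * (n0 + 1)"
  have n: "n > 0" and "n \<ge> n0"
    using k mult_le_mono1[of 1 k "n0 + 1"] by (auto simp: n_def)
  define M :: nat where "M = 2 ^ (a * (n0 + 1))"
  have M: "M > 0" by (simp add: M_def)
  have logM: "log b M = n * R"
    using k by (simp add: M_def n_def R(1) log_nat_power field_simps)
  have M_powr: "real M = b powr (n * R)"
    using b M by (simp flip: logM)
  \<comment> \<open>Together with the key this gives about
    \<open>b powr (n * (?H + 3 * \<eta>))\<close> bins, beating \<open>T2\<close> by
    \<open>2 * \<eta>\<close> in the exponent. As \<open>R <= (1 - \<epsilon>) * ?H\<close>, the
    exponent here is at least \<open>n * (\<epsilon> * ?H + 3 * \<eta>)\<close>, which beats
    \<open>T1\<close> by the same margin.\<close>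
  define Y where "Y = b powr (n * (?H - R + 3 * \<eta>))"
  have "(1 - \<epsilon>) * ?H \<le> 1 * ?H" using \<epsilon> H by (intro mult_right_mono) auto
  hence Y: "Y \<ge> 1" unfolding Y_def
    using b \<eta> R(2) by (intro ge_one_powr_ge_zero mult_nonneg_nonneg) auto
  \<comment> \<open>Rounding up costs at most a factor 2 because \<open>Y >= 1\<close>. This is one
    of the two terms \<open>log b 2\<close> in the leakage; the other comes from Fano's
    inequality.\<close>
  define L where "L = nat \<lceil>Y\<rceil>"
  have L: "Y \<le> L" "L \<le> 2 * Y" "L > 0"
    using Y unfolding L_def by linarith+
  define T1 where "T1 = b powr (n * (\<epsilon> * ?H + \<eta>))"
  define T2 where "T2 = b powr (n * (?H + \<eta>))"
  have T: "T1 > 0" "T2 > 0" using b by (simp_all add: T1_def T2_def)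

  have miss1: "measure_pmf.prob (erasure_block n p g \<epsilon>)
      {(x, y). x \<notin> likely_set p g n (1 / T1) (map2 (\<lambda>_ y. y) x y) (map g x)} \<le> V / (n * \<eta>\<^sup>2)"
  proof -
    have "measure_pmf.prob (erasure_block n p g \<epsilon>)
      {(x, y). x \<notin> likely_set p g n (1 / T1) (map2 (\<lambda>_ y. y) x y) (map g x)}
      \<le> expect ?P (\<lambda>w. (info1 w - \<epsilon> * ?H)\<^sup>2) / (n * \<eta>\<^sup>2)"
      using prob_not_likely_le[OF b n \<eta>, of "\<lambda>_ y. y" p g \<epsilon>, folded info1_def]
      unfolding mean1 T1_def by simp
    also have "\<dots> \<le> V / (n * \<eta>\<^sup>2)"
      by (intro divide_right_mono) (auto simp: V_def)
    finally show ?thesis .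
  qed
  have miss2: "measure_pmf.prob (erasure_block n p g \<epsilon>)
      {(x, y). x \<notin> likely_set p g n (1 / T2) (map2 (\<lambda>_ _. None) x y) (map g x)} \<le> V / (n * \<eta>\<^sup>2)"
  proof -
    have "measure_pmf.prob (erasure_block n p g \<epsilon>)
      {(x, y). x \<notin> likely_set p g n (1 / T2) (map2 (\<lambda>_ _. None) x y) (map g x)}
      \<le> expect ?P (\<lambda>w. (info2 w - ?H)\<^sup>2) / (n * \<eta>\<^sup>2)"
      using prob_not_likely_le[OF b n \<eta>, of "\<lambda>_ _. None" p g \<epsilon>, unfolded option.case, folded info2_def]
      unfolding mean2 T2_def by simp
    also have "\<dots> \<le> V / (n * \<eta>\<^sup>2)"
      by (intro divide_right_mono) (auto simp: V_def)
    finally show ?thesis .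
  qed
  have "T1 / L \<le> T1 / Y"
    using T Y L by (intro divide_left_mono) auto
  also have "\<dots> = b powr (n * (\<epsilon> * ?H + \<eta>) - n * (?H - R + 3 * \<eta>))"
    by (simp add: T1_def Y_def powr_diff)
  also have "\<dots> \<le> b powr (- 2 * real n * \<eta>)"
  proof (rule powr_mono)
    have "n * (R - (1 - \<epsilon>) * ?H) \<le> 0"
      using R(2) by (intro mult_nonneg_nonpos) auto
    thus "n * (\<epsilon> * ?H + \<eta>) - n * (?H - R + 3 * \<eta>) \<le> - 2 * real n * \<eta>"
      by (simp add: algebra_simps)
  qed (use b in auto)
  finally have coll1: "2 * T1 / L \<le> 2 * b powr (- 2 * real n * \<eta>)" by simp
  have "T2 / (real L * real M) \<le> T2 / (Y * real M)"
    using T Y L M by (intro divide_left_mono mult_right_mono) auto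
  also have "\<dots> = b powr (n * (?H + \<eta>) - n * (?H - R + 3 * \<eta>) - n * R)"
    by (simp add: T2_def Y_def powr_diff M_powr)
  also have "n * (?H + \<eta>) - n * (?H - R + 3 * \<eta>) - n * R = - 2 * real n * \<eta>"
    by (simp add: algebra_simps)
  finally have coll2: "2 * T2 / (real L * real M) \<le> 2 * b powr (- 2 * real n * \<eta>)" by simp

  obtain c h d d' where c: "\<And>x. c x < L" and h: "\<And>x. h x < M" and
    "measure_pmf.prob (erasure_block n p g \<epsilon>) {(x, y). d y (map g x) (c x) \<noteq> x}
      \<le> measure_pmf.prob (erasure_block n p g \<epsilon>)
          {(x, y). x \<notin> likely_set p g n (1 / T1) (map2 (\<lambda>_ y. y) x y) (map g x)} + 2 * T1 / L"
    "measure_pmf.prob (replicate_pmf n p) {x. d' (map g x) (c x) (h x) \<noteq> x}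
      \<le> measure_pmf.prob (erasure_block n p g \<epsilon>)
          {(x, y). x \<notin> likely_set p g n (1 / T2) (map2 (\<lambda>_ _. None) x y) (map g x)} + 2 * T2 / (real L * real M)"
    using exists_hash_functions[OF L(3) M T, where n=n and p=p and g=g and \<epsilon>=\<epsilon>] by blast
  hence err1: "measure_pmf.prob (erasure_block n p g \<epsilon>) {(x, y). d y (map g x) (c x) \<noteq> x} \<le> e n"
    and err2: "measure_pmf.prob (replicate_pmf n p) {x. d' (map g x) (c x) (h x) \<noteq> x} \<le> e n"
    using miss1 miss2 coll1 coll2 unfolding e_def by linarith+
  have "log b L \<le> log b (2 * Y)"
    using b L Y by simp
  also have "\<dots> = log b 2 + n * (?H - R + 3 * \<eta>)"
    using b Y by (simp add: log_mult_pos) (simp add: Y_def)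
  finally have "log b M + log b L - n * ?H + log b 2 + e n * (n * ?N)
     \<le> n * (2 * log b 2 / n + 3 * \<eta> + e n * ?N)"
    using n by (simp add: logM algebra_simps)
  also have "\<dots> \<le> n * \<delta>"
    using n0[OF \<open>n \<ge> n0\<close>] by (intro mult_left_mono) auto
  finally have leak: "log b M + log b L - n * ?H + log b 2 + e n * (n * ?N) \<le> n * \<delta>" .
  have "is_code b ?P n (log b M / n) \<delta> (pad_protocol n L M g c h d)"
    by (rule is_code_pad_protocol[OF b n L(3) M c h _ err2 leak])
       (use err1 n0[OF \<open>n \<ge> n0\<close>] \<delta> in auto)
  moreover have "log b M / n = R"
    using n by (simp add: logM)
  moreover have "rounds (pad_protocol n L M g c h d) = 1"
    by (simp add: pad_protocol_def)
  ultimately show ?thesis by auto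
qed

text \<open>The rates of \<open>exists_code\<close> form a grid of step \<open>log b 2 / k\<close>.
  The largest grid point below the claimed capacity misses it by at most one step, and the step
  tends to 0.\<close>

lemma one_way_secret_key_capacity_ge:
  fixes p :: "'x::finite pmf" and g :: "'x \<Rightarrow> 'z::finite"
  assumes \<epsilon>: "0 \<le> \<epsilon>" "\<epsilon> \<le> 1" and b: "1 < b"
  shows "ereal ((1 - \<epsilon>) * post_ent b p g) \<le> one_way_secret_key_capacity b (erasure_source p g \<epsilon>)"
proof -
  let ?C = "(1 - \<epsilon>) * post_ent b p g" and ?l = "log b 2"
  let ?S = "one_way_secret_key_capacity b (erasure_source p g \<epsilon>)"
  have l: "?l > 0" using b by simp
  have C: "?C \<ge> 0" using post_ent_nonneg[OF b, of p g] \<epsilon> by simp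
  have le: "ereal (?C - ?l / real (Suc m)) \<le> ?S" for m
  proof -
    define k where "k = Suc m"
    define a where "a = nat \<lfloor>real k * ?C / ?l\<rfloor>"
    have "real k * ?C / ?l \<ge> 0" using C l by simp
    hence a: "a \<le> real k * ?C / ?l" "real k * ?C / ?l < a + 1"
      unfolding a_def by linarith+
    have "a * ?l \<le> k * ?C" using a(1) l by (simp add: pos_le_divide_eq)
    hence R: "a * ?l / k \<le> ?C" by (simp add: k_def divide_le_eq mult.commute)
    have "k * ?C < (a + 1) * ?l" using a(2) l by (simp add: pos_divide_less_eq)
    hence "?C \<le> (a + 1) * ?l / k" by (simp add: k_def pos_le_divide_eq mult.commute)
    also have "\<dots> = a * ?l / k + ?l / k" by (simp add: add_divide_distrib distrib_right)
    finally have "?C - ?l / k \<le> a * ?l / k" by simp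
    hence "ereal (?C - ?l / k) \<le> ereal (a * ?l / k)" by simp
    also have "\<dots> \<le> ?S"
      unfolding one_way_secret_key_capacity_def key_capacity_def
    proof (rule SUP_upper)
      show "a * ?l / k \<in> {R. achievable b {\<pi>. rounds \<pi> = 1} (erasure_source p g \<epsilon>) R}"
        unfolding achievable_def mem_Collect_eq
        using exists_code[OF \<epsilon> b _ _ refl R] by (auto simp: k_def)
    qed
    finally show ?thesis by (simp add: k_def)
  qed
  have "(\<lambda>m. ?C - ?l / real (Suc m)) \<longlonglongrightarrow> ?C - 0"
    by (rule tendsto_diff[OF tendsto_const LIMSEQ_Suc[OF lim_const_over_n]])
  hence "(\<lambda>m. ereal (?C - ?l / real (Suc m))) \<longlonglongrightarrow> ereal ?C"
    by simp
  thus ?thesis by (rule LIMSEQ_le_const2) (use le in auto)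
qed

theorem mainTheorem13:
  fixes p :: "'x::finite pmf" and g :: "'x \<Rightarrow> 'z::finite" and \<epsilon> b :: real
  assumes "0 \<le> \<epsilon>" and "\<epsilon> \<le> 1" and "1 < b"
  defines "P \<equiv> erasure_source p g \<epsilon>"
  shows "secret_key_capacity b P = ereal (cond_mut_inf b P rv_X rv_Y rv_Z)
    \<and> cond_mut_inf b P rv_X rv_Y rv_Z = (1 - \<epsilon>) * cond_ent b P rv_X rv_Z
    \<and> one_way_secret_key_capacity b P = ereal (cond_mut_inf b P rv_X rv_Y rv_Z)"
proof -
  let ?C = "(1 - \<epsilon>) * post_ent b p g"
  have "ereal ?C \<le> one_way_secret_key_capacity b P"
    unfolding P_def by (rule one_way_secret_key_capacity_ge[OF assms(1-3)])
  moreover have "one_way_secret_key_capacity b P \<le> secret_key_capacity b P"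
    unfolding one_way_secret_key_capacity_def secret_key_capacity_def key_capacity_def
  proof (rule SUP_subset_mono)
    show "{R. achievable b {\<pi>. rounds \<pi> = 1} P R} \<subseteq> {R. achievable b UNIV P R}"
      unfolding achievable_def by blast
  qed simp
  moreover have "secret_key_capacity b P \<le> ereal ?C"
    unfolding secret_key_capacity_def key_capacity_def P_def
    by (rule SUP_least) (simp add: achievable_le[OF assms(1-3)])
  ultimately show ?thesis
    unfolding P_def cond_mut_inf_erasure_source[OF assms(1-3)] cond_ent_erasure_source[OF assms(1-3)]
    by auto
qed

end
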